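(* Let $G$ be a locally compact Abelian group with dual group $\widehat G$, and let $(F_n)$ be a Følner sequence in $\widehat G$. Then for every $g\in G\setminus\{0\}$, $$\lim_{n\to\infty}\frac{1}{|F_n|}\int_{F_n}\gamma(g)\,d\gamma=0.$$
   Context: $G$ is written additively; $\widehat G$ is the group of continuous characters $\gamma:G\to\{z\in\mathbb{C}:|z|=1\}$ with its usual locally compact topology, $d\gamma$ is a Haar measure on $\widehat G$, and $|F|$ is the Haar measure of $F\subset\widehat G$. A Følner sequence in $\widehat G$ is an increasing sequence of compact subsets $(F_n)$ of $\widehat G$ (with $|F_n|>0$) such that $|F_n\,\Delta\,(F_n+a)|/|F_n|\to0$ as $n\to\infty$ for every $a\in\widehat G$ (the group operation of $\widehat G$ being written additively here). *)

theory Defs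
  imports "HOL-Analysis.Analysis"
begin

typedef (overloaded) ('a::topological_ab_group_add) dual =
  "{f :: 'a \<Rightarrow> complex. continuous_on UNIV f \<and> (\<forall>x. norm (f x) = 1) \<and>
      (\<forall>x y. f (x + y) = f x * f y)}"
  morphisms char Abs_dual
  by (rule exI[of _ "\<lambda>_. 1"]) auto

setup_lifting type_definition_dual

lemma continuous_on_char: "continuous_on S (char \<gamma>)"
  using char[of \<gamma>] by (auto intro: continuous_on_subset)

lemma norm_char [simp]: "norm (char \<gamma> x) = 1"
  using char[of \<gamma>] by auto

lemma char_add: "char \<gamma> (x + y) = char \<gamma> x * char \<gamma> y"
  using char[of \<gamma>] by auto

text \<open>Additive notation: the sum of two characters is their pointwise product.\<close>

instantiation dual :: (topological_ab_group_add) ab_group_add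
begin

lift_definition zero_dual :: "'a dual" is "\<lambda>_. 1"
  by auto

lift_definition plus_dual :: "'a dual \<Rightarrow> 'a dual \<Rightarrow> 'a dual" is "\<lambda>f g x. f x * g x"
  by (auto simp: norm_mult intro!: continuous_intros)

lift_definition uminus_dual :: "'a dual \<Rightarrow> 'a dual" is "\<lambda>f x. cnj (f x)"
  by (auto intro!: continuous_intros)

definition minus_dual :: "'a dual \<Rightarrow> 'a dual \<Rightarrow> 'a dual" where
  "minus_dual \<gamma> \<delta> = \<gamma> + - \<delta>"

instance
proof
  fix a b c :: "'a dual"
  show "a + b + c = a + (b + c)" by transfer (auto simp: mult.assoc)
  show "a + b = b + a" by transfer (auto simp: mult.commute)
  show "0 + a = a" by transfer auto
  show "- a + a = 0"
    by transfer (auto simp: fun_eq_iff mult.commute[of "cnj _"] complex_norm_square[symmetric])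
  show "a - b = a + - b" by (rule minus_dual_def)
qed

end

lemma char_zero_dual: "char 0 x = 1"
  by transfer simp

lemma char_plus_dual: "char (\<gamma> + \<delta>) x = char \<gamma> x * char \<delta> x"
  by transfer simp

lemma char_uminus_dual: "char (- \<gamma>) x = cnj (char \<gamma> x)"
  by transfer simp

text \<open>The usual topology of the dual is the compact-open topology.\<close>

instantiation dual :: (topological_ab_group_add) topological_space
begin

definition open_dual :: "'a dual set \<Rightarrow> bool" where
  "open_dual = generate_topology {{\<gamma>. char \<gamma> ` K \<subseteq> V} |K V. compact K \<and> open V}"

instance
  by standard
    (auto simp: open_dual_def intro: generate_topology.UNIV generate_topology.Int
      generate_topology.UN)

end

lemma open_char_image_subset:
  assumes "compact K" "open V"
  shows "open {\<gamma>. char \<gamma> ` K \<subseteq> V}"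
  unfolding open_dual_def using assms by (intro generate_topology.Basis) auto

text \<open>Equivalently, convergence in the dual is uniform convergence on compact sets.\<close>

lemma eventually_nhds_dual:
  fixes \<gamma> :: "'a::topological_ab_group_add dual"
  assumes K: "compact K" and e: "e > 0"
  shows "\<forall>\<^sub>F \<delta> in nhds \<gamma>. \<forall>x\<in>K. dist (char \<delta> x) (char \<gamma> x) < e"
proof -
  have "compact (char \<gamma> ` K)"
    using K continuous_on_char by (rule compact_continuous_image[rotated])
  then obtain T where T: "T \<subseteq> char \<gamma> ` K" "finite T" "char \<gamma> ` K \<subseteq> (\<Union>z\<in>T. ball z (e/3))"
    using compactE_image[of "char \<gamma> ` K" "char \<gamma> ` K" "\<lambda>z. ball z (e/3)"] e
    by (metis UN_I centre_in_ball open_ball subsetI zero_less_divide_iff zero_less_numeral)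
  define L where "L z = K \<inter> char \<gamma> -` cball z (e/3)" for z
  have L: "compact (L z)" for z
    unfolding L_def using K
    by (intro compact_Int_closed closed_vimage continuous_on_char) auto
  have "\<forall>\<^sub>F \<delta> in nhds \<gamma>. \<forall>z\<in>T. char \<delta> ` L z \<subseteq> ball z (2*e/3)"
  proof (intro eventually_ball_finite ballI T)
    fix z
    have "\<gamma> \<in> {\<delta>. char \<delta> ` L z \<subseteq> ball z (2*e/3)}"
      using e by (auto simp: L_def)
    then show "\<forall>\<^sub>F \<delta> in nhds \<gamma>. char \<delta> ` L z \<subseteq> ball z (2*e/3)"
      using open_char_image_subset[OF L, of "ball z (2*e/3)"]
      unfolding eventually_nhds by blast
  qed
  then show ?thesis
  proof (rule eventually_mono, intro ballI)
    fix \<delta> x assume *: "\<forall>z\<in>T. char \<delta> ` L z \<subseteq> ball z (2*e/3)" and "x \<in> K"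
    then obtain z where z: "z \<in> T" "char \<gamma> x \<in> ball z (e/3)"
      using T by blast
    then have "x \<in> L z"
      using \<open>x \<in> K\<close> by (auto simp: L_def)
    then have "char \<delta> x \<in> ball z (2*e/3)"
      using * z(1) by blast
    then show "dist (char \<delta> x) (char \<gamma> x) < e"
      using z(2) dist_triangle3[of "char \<delta> x" "char \<gamma> x" z] by simp
  qed
qed

lemma tendsto_dualI:
  fixes \<gamma> :: "'a::topological_ab_group_add dual"
  assumes "\<And>K e. compact K \<Longrightarrow> e > 0 \<Longrightarrow> \<forall>\<^sub>F y in F. \<forall>x\<in>K. dist (char (f y) x) (char \<gamma> x) < e"
  shows "(f \<longlongrightarrow> \<gamma>) F"
  unfolding nhds_generated_topology[OF open_dual_def] filterlim_INF filterlim_principal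
proof (intro ballI, elim CollectE conjE exE)
  fix S K and V :: "complex set"
  assume S: "\<gamma> \<in> S" "S = {\<gamma>. char \<gamma> ` K \<subseteq> V}" and K: "compact K" and V: "open V"
  have "compact (char \<gamma> ` K)"
    using K continuous_on_char by (rule compact_continuous_image[rotated])
  moreover have "char \<gamma> ` K \<subseteq> V"
    using S by auto
  ultimately obtain e where e: "e > 0" "(\<Union>z\<in>char \<gamma> ` K. ball z e) \<subseteq> V"
    using compact_subset_open_imp_ball_epsilon_subset[OF _ V] by blast
  from assms[OF K e(1)] show "\<forall>\<^sub>F y in F. f y \<in> S"
  proof (rule eventually_mono)
    fix y assume *: "\<forall>x\<in>K. dist (char (f y) x) (char \<gamma> x) < e"
    have "char (f y) x \<in> V" if "x \<in> K" for x
      using *[rule_format, OF that] that by (intro subsetD[OF e(2)]) (auto simp: dist_commute)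
    then show "f y \<in> S"
      using S(2) by auto
  qed
qed

instance dual :: (topological_ab_group_add) topological_ab_group_add
proof
  fix a b :: "'a dual"
  show "LIM x nhds a \<times>\<^sub>F nhds b. fst x + snd x :> nhds (a + b)"
  proof (rule tendsto_dualI)
    fix K :: "'a set" and e :: real
    assume K: "compact K" and "e > 0"
    then have e: "e/2 > 0" by simp
    have "\<forall>\<^sub>F p in nhds a \<times>\<^sub>F nhds b. (\<forall>x\<in>K. dist (char (fst p) x) (char a x) < e/2) \<and>
        (\<forall>x\<in>K. dist (char (snd p) x) (char b x) < e/2)"
      using eventually_prodI[OF eventually_nhds_dual[OF K e] eventually_nhds_dual[OF K e]] .
    then show "\<forall>\<^sub>F p in nhds a \<times>\<^sub>F nhds b.
        \<forall>x\<in>K. dist (char (fst p + snd p) x) (char (a + b) x) < e"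
    proof (rule eventually_mono, intro ballI)
      fix p x assume *: "(\<forall>x\<in>K. dist (char (fst p) x) (char a x) < e/2) \<and>
        (\<forall>x\<in>K. dist (char (snd p) x) (char b x) < e/2)" and x: "x \<in> K"
      have "char (fst p) x * char (snd p) x - char a x * char b x =
          (char (fst p) x - char a x) * char (snd p) x + char a x * (char (snd p) x - char b x)"
        by (simp add: algebra_simps)
      from norm_triangle_ineq[of "(char (fst p) x - char a x) * char (snd p) x"
          "char a x * (char (snd p) x - char b x)", folded this]
      have "norm (char (fst p) x * char (snd p) x - char a x * char b x)
          \<le> norm (char (fst p) x - char a x) + norm (char (snd p) x - char b x)"
        by (simp add: norm_mult)
      also have "\<dots> < e"
        using * x by (fastforce simp: dist_norm)
      finally show "dist (char (fst p + snd p) x) (char (a + b) x) < e"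
        by (simp add: char_plus_dual dist_norm)
    qed
  qed
  show "(uminus \<longlongrightarrow> - a) (nhds a)"
  proof (rule tendsto_dualI)
    fix K :: "'a set" and e :: real
    assume "compact K" "e > 0"
    then show "\<forall>\<^sub>F y in nhds a. \<forall>x\<in>K. dist (char (- y) x) (char (- a) x) < e"
      using eventually_nhds_dual[of K e a]
      by (simp add: char_uminus_dual dist_norm flip: complex_cnj_diff)
  qed
qed

instance dual :: (topological_ab_group_add) t2_space
proof
  fix a b :: "'a dual" assume "a \<noteq> b"
  then obtain x where "char a x \<noteq> char b x"
    by (metis char_inject ext)
  then obtain U V where "open U" "open V" "char a x \<in> U" "char b x \<in> V" "U \<inter> V = {}"
    by (metis hausdorff)
  then show "\<exists>U V. open U \<and> open V \<and> a \<in> U \<and> b \<in> V \<and> U \<inter> V = {}"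
    using open_char_image_subset[of "{x}" U] open_char_image_subset[of "{x}" V]
    by (intro exI[of _ "{\<gamma>. char \<gamma> ` {x} \<subseteq> _}"] conjI) auto
qed

text \<open>Regularity is part of the definition (outer regularity on Borel sets, inner regularity on
  open sets), since the group need not be second countable.\<close>

definition haar_measure :: "'b::{topological_ab_group_add, t2_space} measure \<Rightarrow> bool" where
  "haar_measure M \<longleftrightarrow>
     sets M = sets borel \<and>
     emeasure M UNIV \<noteq> 0 \<and>
     (\<forall>a. \<forall>A \<in> sets borel. emeasure M ((+) a ` A) = emeasure M A) \<and>
     (\<forall>K. compact K \<longrightarrow> emeasure M K < \<infinity>) \<and>
     (\<forall>A \<in> sets borel. emeasure M A = (INF U \<in> {U. open U \<and> A \<subseteq> U}. emeasure M U)) \<and>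
     (\<forall>U. open U \<longrightarrow> emeasure M U = (SUP K \<in> {K. compact K \<and> K \<subseteq> U}. emeasure M K))"

definition folner_sequence ::
    "'b::{topological_ab_group_add, t2_space} measure \<Rightarrow> (nat \<Rightarrow> 'b set) \<Rightarrow> bool" where
  "folner_sequence M F \<longleftrightarrow>
     incseq F \<and>
     (\<forall>n. compact (F n) \<and> measure M (F n) > 0) \<and>
     (\<forall>a. (\<lambda>n. measure M (sym_diff (F n) ((+) a ` F n)) / measure M (F n)) \<longlonglongrightarrow> 0)"

end

theory Submission
  imports Defs
begin

text \<open>Let \<open>a\<close> be a character. Translating \<open>F n\<close> by \<open>a\<close> multiplies the integral of
  \<open>\<gamma> \<mapsto> \<gamma>(g)\<close> over \<open>F n\<close> by \<open>a(g)\<close>, and it changes that integral by at most the measure of the symmetric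
  difference. So \<open>\<bar>1 - a(g)\<bar>\<close> times the modulus of the average is at most the Folner ratio of \<open>a\<close>, and
  the averages tend to zero as soon as some character has \<open>a(g) \<noteq> 1\<close>. The substance is therefore
  that the characters of a locally compact abelian group separate points
  (\<open>characters_separate_points\<close>).

  Characters are obtained as extreme points. Consider pairs
  \<open>(\<phi>, \<psi>)\<close> of functions on the group such that \<open>\<phi>\<close> is of positive type with \<open>\<phi> 0 = 1\<close>,
  \<open>\<psi>\<close> is dominated by a constant multiple \<open>C\<close> of \<open>\<phi>\<close>, and \<open>\<psi>(\<cdot> + y) - \<psi>\<close> is dominated by
  \<open>\<omega> y\<close> times \<open>\<phi>\<close>. These conditions are closed and bounded at each point, so for fixed \<open>C\<close> and \<open>\<omega>\<close> the pairs
  form a compact set for pointwise convergence. At an extreme point \<open>\<phi>\<close> is a homomorphism to the circle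
  and \<open>\<psi>\<close> is a multiple of \<open>\<phi>\<close> (\<open>extreme_pair_multiplicative\<close>). Continuity of \<open>\<phi>\<close> is then read off
  from \<open>\<bar>\<psi> 0\<bar> \<bar>\<phi> y - 1\<bar> \<le> \<omega> y\<close>, provided that \<open>\<omega>\<close> tends to 0 at 0 and \<open>\<psi> 0 \<noteq> 0\<close>. An extreme point
  that maximises \<open>Re (\<psi> 0 - \<psi> g)\<close> satisfies \<open>\<phi> g \<noteq> 1\<close> and \<open>\<psi> 0 \<noteq> 0\<close>, provided that this maximum is
  positive (\<open>exists_char_from_pair\<close>).

  To start, one pair with \<open>Re (\<psi> 0 - \<psi> g) > 0\<close> is needed. Take a bump function \<open>f\<close> near 0, its
  autocorrelation \<open>\<phi>\<close>, and \<open>\<psi> x = \<integral> f s * \<phi> (x + s) ds\<close>. Then \<open>C = \<integral>\<bar>f\<bar>\<close> and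
  \<open>\<omega> y = \<integral>\<bar>f (s - y) - f s\<bar> ds\<close> work, by nothing more than the bound \<open>\<bar>\<phi>\<bar> \<le> \<phi> 0\<close> for functions
  of positive type (\<open>autocorr_smear_dominated\<close>).

  The integral has to be invariant, positive and nonzero. It is constructed as
  a functional on all bounded functions with compact support: sum over a maximal separated subset
  of the group, which gives a quasi-invariant functional, and then average over all translates with
  an invariant mean (\<open>exists_invariant_integral\<close>). The mean exists because the group is abelian.\<close>

section \<open>Extreme points of compact sets of functions\<close>

text \<open>Tychonoff's theorem for the topology of pointwise convergence.\<close>

lemma compact_box:
  fixes K :: "'i \<Rightarrow> 'b::topological_space set"
  assumes "\<And>i. compact (K i)"
  shows "compact {f. \<forall>i. f i \<in> K i}"
proof -
  have "compactin (product_topology (\<lambda>i::'i. euclidean) UNIV) (PiE UNIV K)"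
    using assms by (simp add: compactin_PiE)
  moreover have "PiE UNIV K = {f. \<forall>i. f i \<in> K i}"
    by (auto simp: PiE_def Pi_def)
  ultimately show ?thesis
    by (simp add: euclidean_product_topology)
qed

text \<open>As in the Krein-Milman theorem: a minimal closed face exists by Zorn's lemma and compactness, and
  maximising a coordinate cuts out a smaller face unless that coordinate is constant on the face, so a
  minimal face is a single point.\<close>

lemma exists_extreme_point:
  fixes S :: "('i \<Rightarrow> 'b::euclidean_space) set"
  assumes "compact S" "closed S" "S \<noteq> {}"
  obtains e where "e \<in> S"
    "\<And>p q t. p \<in> S \<Longrightarrow> q \<in> S \<Longrightarrow> 0 < t \<Longrightarrow> t < 1 \<Longrightarrow>
       e = (\<lambda>i. t *\<^sub>R p i + (1 - t) *\<^sub>R q i) \<Longrightarrow> p = e \<and> q = e"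
proof -
  define mix :: "real \<Rightarrow> ('i \<Rightarrow> 'b) \<Rightarrow> ('i \<Rightarrow> 'b) \<Rightarrow> 'i \<Rightarrow> 'b"
    where "mix t p q = (\<lambda>i. t *\<^sub>R p i + (1 - t) *\<^sub>R q i)" for t p q
  define faces where "faces = {E. E \<subseteq> S \<and> closed E \<and> E \<noteq> {} \<and>
    (\<forall>p\<in>S. \<forall>q\<in>S. \<forall>t. 0 < t \<longrightarrow> t < 1 \<longrightarrow> mix t p q \<in> E \<longrightarrow> p \<in> E \<and> q \<in> E)}"
  have "\<exists>E\<in>faces. \<forall>D\<in>faces. D \<subseteq> E \<longrightarrow> D = E"
  proof (rule predicate_Zorn[where P = "\<lambda>E D. D \<subseteq> E"])
    show "partial_order_on faces (relation_of (\<lambda>E D. D \<subseteq> E) faces)"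
      by (rule partial_order_on_relation_ofI) auto
  next
    fix C assume "C \<in> Chains (relation_of (\<lambda>E D. D \<subseteq> E) faces)"
    then have C: "C \<subseteq> faces" and chain: "\<And>D E. D \<in> C \<Longrightarrow> E \<in> C \<Longrightarrow> D \<subseteq> E \<or> E \<subseteq> D"
      by (auto simp: Chains_def relation_of_def)
    show "\<exists>D\<in>faces. \<forall>E\<in>C. D \<subseteq> E"
    proof (intro bexI[of _ "S \<inter> \<Inter>C"] ballI)
      have "S \<inter> \<Inter>C \<noteq> {}"
      proof (rule compact_imp_fip[OF assms(1)])
        show "closed D" if "D \<in> C" for D
          using C that by (auto simp: faces_def)
        show "S \<inter> \<Inter>B \<noteq> {}" if "finite B" "B \<subseteq> C" for B
        proof (cases "B = {}")
          case False
          have "\<Inter>B \<in> B"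
            using that(1) False that(2)
          proof (induction B rule: finite_ne_induct)
            case (insert D B)
            then have "\<Inter>B \<in> B" "D \<subseteq> \<Inter>B \<or> \<Inter>B \<subseteq> D"
              using chain[of D "\<Inter>B"] by blast+
            moreover have "\<Inter>(insert D B) = D \<inter> \<Inter>B"
              by simp
            ultimately show ?case
              by (metis inf.absorb1 inf.absorb2 insert_iff)
          qed auto
          then have "\<Inter>B \<in> faces"
            using that C by blast
          then have "\<Inter>B \<subseteq> S" "\<Inter>B \<noteq> {}"
            unfolding faces_def by simp_all
          then show ?thesis
            by (simp add: Int_absorb1)
        qed (use assms in auto)
      qed
      moreover have "closed (S \<inter> \<Inter>C)"
        using C assms(2) by (intro closed_Int closed_Inter) (auto simp: faces_def)
      moreover have "p \<in> S \<inter> \<Inter>C \<and> q \<in> S \<inter> \<Inter>C"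
        if "p \<in> S" "q \<in> S" "0 < t" "t < 1" "mix t p q \<in> S \<inter> \<Inter>C" for p q t
      proof -
        have "p \<in> D \<and> q \<in> D" if "D \<in> C" for D
        proof -
          have "D \<in> faces" "mix t p q \<in> D"
            using that C \<open>mix t p q \<in> S \<inter> \<Inter>C\<close> by blast+
          then show ?thesis
            using \<open>p \<in> S\<close> \<open>q \<in> S\<close> \<open>0 < t\<close> \<open>t < 1\<close> unfolding faces_def by simp
        qed
        then show ?thesis
          using that by blast
      qed
      ultimately show "S \<inter> \<Inter>C \<in> faces"
        unfolding faces_def by blast
    qed auto
  qed
  then obtain E where E: "E \<in> faces" and min: "\<And>D. D \<in> faces \<Longrightarrow> D \<subseteq> E \<Longrightarrow> D = E"
    by blast
  have "compact E"
    using compact_Int_closed[OF assms(1), of E] E by (simp add: faces_def Int_absorb1)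
  have const: "p i \<bullet> b = q i \<bullet> b" if pq: "p \<in> E" "q \<in> E" for p q i b
  proof -
    have cont: "continuous_on UNIV (\<lambda>f::'i \<Rightarrow> 'b. f i \<bullet> b)"
      by (intro continuous_intros) auto
    obtain m where m: "m \<in> E" "\<And>f. f \<in> E \<Longrightarrow> f i \<bullet> b \<le> m i \<bullet> b"
      using continuous_attains_sup[OF \<open>compact E\<close> _ continuous_on_subset[OF cont]] E
      by (auto simp: faces_def)
    define D where "D = E \<inter> {f. f i \<bullet> b = m i \<bullet> b}"
    have "closed D"
      unfolding D_def using E
      by (intro closed_Int closed_Collect_eq cont) (auto simp: faces_def)
    moreover have "r \<in> D \<and> s \<in> D"
      if rs: "r \<in> S" "s \<in> S" and t: "0 < t" "t < 1" and mx: "mix t r s \<in> D" for r s t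
    proof -
      have rsE: "r \<in> E" "s \<in> E"
        using E rs t mx by (auto simp: faces_def D_def)
      have "t * (r i \<bullet> b) + (1 - t) * (s i \<bullet> b) = m i \<bullet> b"
        using mx by (simp add: D_def mix_def inner_add_left)
      then have *: "t * (m i \<bullet> b - r i \<bullet> b) + (1 - t) * (m i \<bullet> b - s i \<bullet> b) = 0"
        by (simp add: algebra_simps)
      have "t * (m i \<bullet> b - r i \<bullet> b) \<ge> 0" "(1 - t) * (m i \<bullet> b - s i \<bullet> b) \<ge> 0"
        using m(2)[OF rsE(1)] m(2)[OF rsE(2)] t by auto
      with * have "t * (m i \<bullet> b - r i \<bullet> b) = 0" "(1 - t) * (m i \<bullet> b - s i \<bullet> b) = 0"
        by linarith+
      then show ?thesis
        using t rsE by (simp add: D_def)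
    qed
    ultimately have "D \<in> faces"
      using E m(1) by (auto simp: faces_def D_def)
    then have "D = E"
      using min by (simp add: D_def)
    then have "p \<in> D" "q \<in> D"
      using pq by simp_all
    then show ?thesis
      by (simp add: D_def)
  qed
  obtain e where e: "e \<in> E"
    using E by (auto simp: faces_def)
  have single: "p = e" if "p \<in> E" for p
    using const[OF that e] by (auto intro!: euclidean_eqI[where 'a='b])
  show ?thesis
  proof
    show "e \<in> S"
      using e E by (auto simp: faces_def)
    show "p = e \<and> q = e" if "p \<in> S" "q \<in> S" "0 < t" "t < 1"
      "e = (\<lambda>i. t *\<^sub>R p i + (1 - t) *\<^sub>R q i)" for p q t
    proof -
      have "mix t p q \<in> E"
        using that e by (simp add: mix_def)
      then have "p \<in> E \<and> q \<in> E"
        using that E unfolding faces_def by blast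
      then show ?thesis
        using single by blast
    qed
  qed
qed

section \<open>Invariant means on abelian groups\<close>

definition mean :: "(('a \<Rightarrow> real) \<Rightarrow> real) \<Rightarrow> bool" where
  "mean m \<longleftrightarrow>
     (\<forall>f g. bounded (range f) \<longrightarrow> bounded (range g) \<longrightarrow> m (\<lambda>x. f x + g x) = m f + m g) \<and>
     (\<forall>f c. bounded (range f) \<longrightarrow> m (\<lambda>x. c * f x) = c * m f) \<and>
     (\<forall>f. bounded (range f) \<longrightarrow> (\<forall>x. 0 \<le> f x) \<longrightarrow> 0 \<le> m f) \<and>
     m (\<lambda>_. 1) = 1"

lemma bounded_range_iff: "bounded (range f) \<longleftrightarrow> (\<exists>B. \<forall>x. norm (f x) \<le> B)"
  by (auto simp: bounded_iff)

lemma bounded_range_const [simp]: "bounded (range (\<lambda>_. c))"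
  by (rule finite_imp_bounded) simp

lemma bounded_range_add:
  fixes f g :: "'a \<Rightarrow> 'b::real_normed_vector"
  assumes "bounded (range f)" "bounded (range g)"
  shows "bounded (range (\<lambda>x. f x + g x))"
  using bounded_plus_comp[OF assms] .

lemma bounded_range_mult:
  fixes f g :: "'a \<Rightarrow> 'b::real_normed_algebra"
  assumes "bounded (range f)" "bounded (range g)"
  shows "bounded (range (\<lambda>x. f x * g x))"
proof -
  obtain B C where B: "\<And>x. norm (f x) \<le> B" and C: "\<And>x. norm (g x) \<le> C"
    using assms by (auto simp: bounded_range_iff)
  have "norm (f x * g x) \<le> B * C" for x
    using norm_mult_ineq mult_mono[OF B C]
    by (metis B norm_ge_zero order_trans)
  then show ?thesis
    by (auto simp: bounded_range_iff)
qed

lemma bounded_range_compose: "bounded (range f) \<Longrightarrow> bounded (range (\<lambda>x. f (h x)))"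
  by (erule bounded_subset) auto

lemma mean_add:
  "mean m \<Longrightarrow> bounded (range f) \<Longrightarrow> bounded (range g) \<Longrightarrow> m (\<lambda>x. f x + g x) = m f + m g"
  by (simp add: mean_def)

lemma mean_scale: "mean m \<Longrightarrow> bounded (range f) \<Longrightarrow> m (\<lambda>x. c * f x) = c * m f"
  by (simp add: mean_def)

lemma mean_nonneg: "mean m \<Longrightarrow> bounded (range f) \<Longrightarrow> (\<And>x. 0 \<le> f x) \<Longrightarrow> 0 \<le> m f"
  by (simp add: mean_def)

lemma mean_one: "mean m \<Longrightarrow> m (\<lambda>_. 1) = 1"
  by (simp add: mean_def)

lemma mean_abs_le:
  assumes m: "mean m" and B: "\<And>x. \<bar>f x\<bar> \<le> B"
  shows "\<bar>m f\<bar> \<le> B"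
proof -
  have f: "bounded (range f)"
    using B by (auto simp: bounded_range_iff)
  have cf: "bounded (range (\<lambda>x. c * f x))" for c
    by (intro bounded_range_mult bounded_range_const f)
  have "0 \<le> m (\<lambda>x. B * 1 + c * f x)" if "c = 1 \<or> c = - 1" for c
  proof (rule mean_nonneg[OF m])
    show "0 \<le> B * 1 + c * f x" for x
      using B[of x] that by auto
    show "bounded (range (\<lambda>x. B * 1 + c * f x))"
      by (intro bounded_range_add bounded_range_const cf)
  qed
  moreover have "m (\<lambda>x. B * 1 + c * f x) = B + c * m f" for c
    using mean_add[OF m bounded_range_const cf[of c], of "B * 1"]
      mean_scale[OF m bounded_range_const, of B 1] mean_scale[OF m f, of c] mean_one[OF m]
    by simp
  ultimately have "0 \<le> B + 1 * m f" "0 \<le> B + (- 1) * m f"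
    by metis+
  then show ?thesis
    by linarith
qed

text \<open>The means form a compact set, so it suffices to satisfy finitely many constraints: invariance under
  a translation \<open>a\<close> up to an error \<open>2 B / (n + 1)\<close>. Averaging a mean over \<open>0, a, \<dots>, n a\<close>
  achieves one constraint, because the sum telescopes. Since the group is abelian, averages commute
  with translations, so averaging does not spoil the constraints achieved before.\<close>

lemma exists_invariant_mean:
  obtains m :: "('a::ab_group_add \<Rightarrow> real) \<Rightarrow> real" where
    "mean m" "\<And>f a. bounded (range f) \<Longrightarrow> m (\<lambda>x. f (x + a)) = m f"
proof -
  \<comment> \<open>Means only matter on bounded functions; the value 0 elsewhere keeps them inside a compact box.\<close>
  define N :: "('a \<Rightarrow> real) \<Rightarrow> real"
    where "N f = (if bounded (range f) then SUP x. \<bar>f x\<bar> else 0)" for f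
  define box :: "(('a \<Rightarrow> real) \<Rightarrow> real) set" where "box = {m. \<forall>f. m f \<in> {- N f..N f}}"
  define means :: "(('a \<Rightarrow> real) \<Rightarrow> real) set"
    where "means = {m. mean m \<and> (\<forall>f. \<not> bounded (range f) \<longrightarrow> m f = 0)}"
  define E :: "'a \<times> nat \<Rightarrow> (('a \<Rightarrow> real) \<Rightarrow> real) set"
    where "E = (\<lambda>(a, n). {m. \<forall>f B. (\<forall>x. \<bar>f x\<bar> \<le> B) \<longrightarrow>
      \<bar>m (\<lambda>x. f (x + a)) - m f\<bar> \<le> 2 * B / real (Suc n)})"
  have ev: "continuous_on UNIV (\<lambda>m::('a \<Rightarrow> real) \<Rightarrow> real. m f)" for f
    by simp
  have "box \<inter> (\<Inter>T\<in>insert means (range E). T) \<noteq> {}"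
  proof (rule compact_imp_fip_image)
    show "compact box"
      unfolding box_def by (rule compact_box) simp
    show "closed T" if "T \<in> insert means (range E)" for T
    proof -
      have *: "closed means"
        unfolding means_def mean_def
        by (intro closed_Collect_conj closed_Collect_all closed_Collect_imp closed_Collect_eq
            closed_Collect_le continuous_intros ev open_Collect_const)
      have "closed (E p)" for p
        unfolding E_def case_prod_beta
        by (intro closed_Collect_all closed_Collect_imp closed_Collect_le continuous_intros ev
            open_Collect_const)
      with * show ?thesis
        using that by blast
    qed
    fix \<T> assume "finite \<T>" "\<T> \<subseteq> insert means (range E)"
    then have "finite (\<T> - {means})" "\<T> - {means} \<subseteq> E ` UNIV"
      by auto
    then obtain P where P: "finite P" "\<T> - {means} = E ` P"
      using finite_subset_image by metis
    have "\<exists>m\<in>means. \<forall>p\<in>P. m \<in> E p"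
      using P(1)
    proof (induction P)
      case empty
      define m0 where "m0 = (\<lambda>f::'a \<Rightarrow> real. if bounded (range f) then f 0 else 0)"
      have "m0 \<in> means"
        using bounded_range_add[where ?'a='a and ?'b=real]
          bounded_range_mult[OF bounded_range_const, where ?'a='a and ?'b=real]
        by (auto simp: means_def m0_def mean_def)
      then show ?case by auto
    next
      case (insert p P)
      then obtain m where m: "m \<in> means" "\<And>p. p \<in> P \<Longrightarrow> m \<in> E p"
        by blast
      obtain a n where p: "p = (a, n)"
        by (cases p)
      define s :: "nat \<Rightarrow> 'a" where "s k = ((+) a ^^ k) 0" for k
      have s: "s 0 = 0" "s (Suc k) = s k + a" for k
        by (simp_all add: s_def add.commute)
      define avg :: "('a \<Rightarrow> real) \<Rightarrow> 'a \<Rightarrow> real"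
        where "avg f = (\<lambda>x. 1 / real (Suc n) * (\<Sum>k\<le>n. f (x + s k)))" for f
      have avg_le: "\<bar>avg f x\<bar> \<le> B" if "\<And>x. \<bar>f x\<bar> \<le> B" for f B x
      proof -
        have "\<bar>\<Sum>k\<le>n. f (x + s k)\<bar> \<le> (\<Sum>k\<le>n. B)"
          using that by (intro order_trans[OF sum_abs] sum_mono)
        then show ?thesis
          by (simp add: avg_def abs_mult field_simps)
      qed
      have avg_bd: "bounded (range (avg f))" if "bounded (range f)" for f
        using that avg_le by (metis bounded_range_iff real_norm_def)
      define m' where "m' f = (if bounded (range f) then m (avg f) else 0)" for f
      have mm: "mean m"
        using m by (simp add: means_def)
      have "mean m'"
        unfolding mean_def
      proof (intro conjI allI impI)
        fix f g :: "'a \<Rightarrow> real" and c :: real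
        assume f: "bounded (range f)"
        have "avg (\<lambda>x. c * f x) = (\<lambda>x. c * avg f x)"
          by (auto simp: avg_def sum_distrib_left mult_ac)
        then show "m' (\<lambda>x. c * f x) = c * m' f"
          using f avg_bd[OF f] bounded_range_mult[OF bounded_range_const f] mm
          by (simp add: m'_def mean_def)
        show "0 \<le> m' f" if "\<forall>x. 0 \<le> f x"
          using that f avg_bd[OF f] mm
          by (auto simp: m'_def mean_def avg_def intro!: sum_nonneg divide_nonneg_nonneg)
        assume g: "bounded (range g)"
        have "avg (\<lambda>x. f x + g x) = (\<lambda>x. avg f x + avg g x)"
          by (auto simp: avg_def sum.distrib algebra_simps add_divide_distrib)
        then show "m' (\<lambda>x. f x + g x) = m' f + m' g"
          using f g avg_bd[OF f] avg_bd[OF g] bounded_range_add[OF f g] mm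
          by (simp add: m'_def mean_def)
      next
        have "avg (\<lambda>_. 1) = (\<lambda>_. 1)"
          by (auto simp: avg_def)
        then show "m' (\<lambda>_. 1) = 1"
          using mm by (simp add: m'_def mean_def)
      qed
      then have "m' \<in> means"
        by (auto simp: means_def m'_def)
      moreover have "m' \<in> E (b, k)" if b: "(b, k) \<in> P" for b k
        unfolding E_def
      proof (clarsimp simp del: of_nat_Suc)
        fix f :: "'a \<Rightarrow> real" and B assume B: "\<forall>x. \<bar>f x\<bar> \<le> B"
        then have f: "bounded (range f)"
          by (auto simp: bounded_range_iff)
        have "avg (\<lambda>x. f (x + b)) = (\<lambda>x. avg f (x + b))"
          by (auto simp: avg_def add_ac)
        moreover have "\<bar>m (\<lambda>x. avg f (x + b)) - m (avg f)\<bar> \<le> 2 * B / real (Suc k)"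
          using m(2)[OF b] avg_le[of f B] B by (simp add: E_def)
        ultimately show "\<bar>m' (\<lambda>x. f (x + b)) - m' f\<bar> \<le> 2 * B / real (Suc k)"
          using f bounded_range_compose[OF f, of "\<lambda>x. x + b"] by (simp add: m'_def)
      qed
      moreover have "m' \<in> E (a, n)"
        unfolding E_def
      proof (clarsimp simp del: of_nat_Suc)
        fix f :: "'a \<Rightarrow> real" and B assume B: "\<forall>x. \<bar>f x\<bar> \<le> B"
        then have f: "bounded (range f)" and f': "bounded (range (\<lambda>x. f (x + a)))"
          by (auto simp: bounded_range_iff)
        have tele: "avg (\<lambda>x. f (x + a)) x + (- 1) * avg f x
            = (f (x + s (Suc n)) - f x) / real (Suc n)" for x
        proof -
          have "(\<Sum>k\<le>n. f (x + s k + a)) - (\<Sum>k\<le>n. f (x + s k))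
              = (\<Sum>k\<le>n. f (x + s (Suc k)) - f (x + s k))"
            by (simp add: sum_subtractf s add_ac)
          also have "\<dots> = f (x + s (Suc n)) - f (x + s 0)"
            by (induction n) (simp_all add: algebra_simps)
          finally show ?thesis
            by (simp add: avg_def s(1) del: of_nat_Suc flip: diff_divide_distrib)
        qed
        have "\<bar>(f (x + s (Suc n)) - f x) / real (Suc n)\<bar> \<le> 2 * B / real (Suc n)" for x
        proof -
          have "\<bar>f (x + s (Suc n)) - f x\<bar> \<le> 2 * B"
            using B[rule_format, of "x + s (Suc n)"] B[rule_format, of x] by linarith
          then show ?thesis
            by (simp add: abs_divide divide_right_mono del: of_nat_Suc)
        qed
        then have "\<bar>m (\<lambda>x. avg (\<lambda>x. f (x + a)) x + (- 1) * avg f x)\<bar> \<le> 2 * B / real (Suc n)"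
          by (intro mean_abs_le[OF mm]) (simp only: tele)
        moreover have "m (\<lambda>x. avg (\<lambda>x. f (x + a)) x + (- 1) * avg f x)
            = m (avg (\<lambda>x. f (x + a))) + (- 1) * m (avg f)"
          unfolding mean_scale[OF mm avg_bd[OF f], symmetric]
          by (intro mean_add mm avg_bd f f' bounded_range_mult bounded_range_const)
        ultimately show "\<bar>m' (\<lambda>x. f (x + a)) - m' f\<bar> \<le> 2 * B / real (Suc n)"
          using f f' by (simp add: m'_def)
      qed
      ultimately show ?case
        using p by (intro bexI[of _ m']) auto
    qed
    then obtain m where m: "m \<in> means" "\<forall>p\<in>P. m \<in> E p"
      by blast
    have "\<bar>m f\<bar> \<le> N f" for f
    proof (cases "bounded (range f)")
      case True
      then obtain B where "\<And>x. \<bar>f x\<bar> \<le> B"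
        by (auto simp: bounded_range_iff)
      then have "\<bar>f x\<bar> \<le> (SUP x. \<bar>f x\<bar>)" for x
        by (intro cSUP_upper) (auto intro!: bdd_aboveI[of _ B])
      moreover have "mean m"
        using m by (simp add: means_def)
      ultimately show ?thesis
        using True by (simp add: N_def mean_abs_le)
    next
      case False
      then show ?thesis
        using m(1) by (simp add: means_def N_def)
    qed
    then have "m \<in> box"
      by (simp add: box_def abs_le_iff minus_le_iff)
    moreover have "m \<in> T" if "T \<in> \<T>" for T
    proof (cases "T = means")
      case False
      then have "T \<in> E ` P"
        using that P(2) by blast
      then show ?thesis
        using m(2) by blast
    qed (use m in simp)
    ultimately show "box \<inter> (\<Inter>T\<in>\<T>. T) \<noteq> {}"
      by blast
  qed
  then obtain m where "m \<in> (\<Inter>T\<in>insert means (range E). T)"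
    by (metis IntE ex_in_conv)
  then have "m \<in> means" and E: "m \<in> E (a, n)" for a n
    by simp_all
  then have m: "mean m"
    by (simp add: means_def)
  show ?thesis
  proof
    show "mean m" by (rule m)
    fix f :: "'a \<Rightarrow> real" and a assume "bounded (range f)"
    then obtain B where B: "\<And>x. \<bar>f x\<bar> \<le> B"
      by (auto simp: bounded_range_iff)
    have "(\<lambda>n. 2 * B / real (Suc n)) \<longlonglongrightarrow> 0"
      using LIMSEQ_Suc[OF lim_const_over_n[of "2*B"]] by simp
    moreover have "\<bar>m (\<lambda>x. f (x + a)) - m f\<bar> \<le> 2 * B / real (Suc n)" for n
      using E[of a n] B unfolding E_def by blast
    ultimately have "\<bar>m (\<lambda>x. f (x + a)) - m f\<bar> \<le> 0"
      by (intro tendsto_lowerbound[of _ 0 sequentially]) auto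
    then show "m (\<lambda>x. f (x + a)) = m f"
      by simp
  qed
qed

section \<open>An invariant integral on a locally compact abelian group\<close>

text \<open>Bounded with compact support. The invariant integral below is defined on all such functions, so that
  products and iterated integrals can be integrated without checking continuity or measurability.\<close>

definition bcs :: "('a::topological_space \<Rightarrow> 'b::real_normed_vector) \<Rightarrow> bool" where
  "bcs h \<longleftrightarrow> bounded (range h) \<and> (\<exists>K. compact K \<and> (\<forall>x. x \<notin> K \<longrightarrow> h x = 0))"

lemma bcsI:
  assumes "compact K" "\<And>x. x \<notin> K \<Longrightarrow> h x = 0" "\<And>x. norm (h x) \<le> B"
  shows "bcs h"
  using assms by (auto simp: bcs_def bounded_range_iff)

lemma bcsE:
  assumes "bcs h"
  obtains K B where "compact K" "\<And>x. x \<notin> K \<Longrightarrow> h x = 0" "\<And>x. norm (h x) \<le> B" "0 < B"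
proof -
  obtain K B where K: "compact K" "\<And>x. x \<notin> K \<Longrightarrow> h x = 0" and B: "\<And>x. norm (h x) \<le> B"
    using assms unfolding bcs_def bounded_range_iff by blast
  have "norm (h x) \<le> max B 1" for x
    using B[of x] by simp
  with K show ?thesis
    by (intro that[of K "max B 1"]) auto
qed

lemma bcs_dominated:
  assumes "bcs h" "\<And>x. norm (k x) \<le> C * norm (h x)"
  shows "bcs k"
proof -
  obtain K B where K: "compact K" "\<And>x. x \<notin> K \<Longrightarrow> h x = 0" and B: "\<And>x. norm (h x) \<le> B"
    using assms(1) by (rule bcsE) blast
  show ?thesis
  proof (rule bcsI[OF K(1)])
    show "k x = 0" if "x \<notin> K" for x
      using assms(2)[of x] K(2)[OF that] by simp
    show "norm (k x) \<le> \<bar>C\<bar> * B" for x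
    proof -
      have "C * norm (h x) \<le> \<bar>C\<bar> * B"
        using B[of x] by (intro mult_mono) auto
      then show ?thesis
        using assms(2)[of x] by linarith
    qed
  qed
qed

lemma bcs_add:
  assumes "bcs f" "bcs g"
  shows "bcs (\<lambda>x. f x + g x)"
proof -
  obtain K where K: "compact K" "\<And>x. x \<notin> K \<Longrightarrow> f x = 0"
    using assms(1) by (rule bcsE) blast
  obtain L where L: "compact L" "\<And>x. x \<notin> L \<Longrightarrow> g x = 0"
    using assms(2) by (rule bcsE) blast
  have "compact (K \<union> L)" "\<forall>x. x \<notin> K \<union> L \<longrightarrow> f x + g x = 0"
    using K L by auto
  moreover have "bounded (range (\<lambda>x. f x + g x))"
    using assms by (intro bounded_range_add) (simp_all add: bcs_def)
  ultimately show ?thesis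
    unfolding bcs_def by blast
qed

lemma bcs_mult_left:
  fixes f g :: "'a::topological_space \<Rightarrow> 'b::real_normed_field"
  assumes "bounded (range f)" "bcs g"
  shows "bcs (\<lambda>x. f x * g x)"
proof -
  obtain C where C: "\<And>x. norm (f x) \<le> C"
    using assms(1) unfolding bounded_range_iff by blast
  show ?thesis
    by (rule bcs_dominated[OF assms(2), of _ C]) (simp add: norm_mult mult_right_mono C)
qed

lemma bcs_mult_right:
  fixes f g :: "'a::topological_space \<Rightarrow> 'b::real_normed_field"
  assumes "bcs f" "bounded (range g)"
  shows "bcs (\<lambda>x. f x * g x)"
  using bcs_mult_left[OF assms(2,1)] by (simp add: mult.commute)

lemma bcs_scale:
  fixes f :: "'a::topological_space \<Rightarrow> 'b::real_normed_field"
  shows "bcs f \<Longrightarrow> bcs (\<lambda>x. c * f x)"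
  by (rule bcs_mult_left[OF bounded_range_const])

lemma bcs_diff: "bcs f \<Longrightarrow> bcs g \<Longrightarrow> bcs (\<lambda>x. f x - g x)"
  using bcs_add[of f "\<lambda>x. - g x"] bcs_dominated[of g "\<lambda>x. - g x" 1] by simp

lemma bcs_norm: "bcs f \<Longrightarrow> bcs (\<lambda>x. norm (f x))"
  by (rule bcs_dominated[of f _ 1]) auto

lemma bcs_abs: "bcs f \<Longrightarrow> bcs (\<lambda>x. \<bar>f x :: real\<bar>)"
  using bcs_norm[of f] by simp

lemma bcs_zero: "bcs (\<lambda>x. 0)"
  by (rule bcsI[of "{}" _ 0]) auto

lemma bcs_sum: "finite A \<Longrightarrow> (\<And>i. i \<in> A \<Longrightarrow> bcs (f i)) \<Longrightarrow> bcs (\<lambda>x. \<Sum>i\<in>A. f i x)"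
  by (induction A rule: finite_induct) (simp_all add: bcs_zero bcs_add)

lemma bcs_indicator: "compact K \<Longrightarrow> bcs (indicator K :: _ \<Rightarrow> real)"
  by (rule bcsI[of K _ 1]) (auto simp: indicator_def)

lemma bcs_shift:
  fixes f :: "'a::topological_ab_group_add \<Rightarrow> 'b::real_normed_vector"
  assumes "bcs f"
  shows "bcs (\<lambda>x. f (x + a))"
proof -
  obtain K B where K: "compact K" "\<And>x. x \<notin> K \<Longrightarrow> f x = 0" and B: "\<And>x. norm (f x) \<le> B"
    using assms by (rule bcsE) blast
  show ?thesis
  proof (rule bcsI[OF _ _ B])
    show "compact ((\<lambda>x. x - a) ` K)"
      using K(1) by (intro compact_continuous_image continuous_intros)
    show "f (x + a) = 0" if "x \<notin> (\<lambda>x. x - a) ` K" for x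
    proof (rule K(2))
      show "x + a \<notin> K"
        using that by (metis add_diff_cancel_right' image_eqI)
    qed
  qed
qed

lemma bcs_Re: "bcs h \<Longrightarrow> bcs (\<lambda>x. Re (h x))"
  by (rule bcs_dominated[of h _ 1]) (auto simp: abs_Re_le_cmod)

lemma bcs_Im: "bcs h \<Longrightarrow> bcs (\<lambda>x. Im (h x))"
  by (rule bcs_dominated[of h _ 1]) (auto simp: abs_Im_le_cmod)

lemma bcs_of_real: "bcs h \<Longrightarrow> bcs (\<lambda>x. complex_of_real (h x))"
  by (rule bcs_dominated[of h _ 1]) auto

lemma bcs_cnj: "bcs v \<Longrightarrow> bcs (\<lambda>x. cnj (v x))"
  by (rule bcs_dominated[of v _ 1]) auto

lemma bcs_bounded: "bcs v \<Longrightarrow> bounded (range v)"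
  by (simp add: bcs_def)

lemma bcs_correlation: "bcs v \<Longrightarrow> bcs (\<lambda>s::'a::topological_ab_group_add. v (s + x) * cnj (v (s + y)))"
  using bcs_shift[of v x] bcs_cnj[OF bcs_shift[of v y]]
  by (intro bcs_mult_left bcs_bounded)

lemma bcs_norm_square: "bcs v \<Longrightarrow> bcs (\<lambda>s. (norm (v s :: complex))\<^sup>2)"
  unfolding power2_eq_square by (intro bcs_mult_left bcs_bounded bcs_norm)

lemma open_translate_vimage:
  fixes N :: "'a::topological_ab_group_add set"
  assumes "open N"
  shows "open {y. y + a \<in> N}"
proof -
  have "open ((\<lambda>y. y + a) -` N)"
    using assms by (intro open_vimage continuous_intros)
  then show ?thesis by (simp add: vimage_def)
qed

text \<open>The two uses are a uniform bound on the number of points of a separated set in translates of a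
  compact set, and the domination of one function by finitely many translates of another.\<close>

lemma finite_cover_translates:
  fixes N :: "'a::topological_ab_group_add set"
  assumes "compact K" "open N" "n \<in> N"
  obtains T where "finite T" "\<And>x. x \<in> K \<Longrightarrow> \<exists>t\<in>T. x + t \<in> N"
proof -
  have "K \<subseteq> (\<Union>k\<in>K. {y. y + (n - k) \<in> N})"
    using assms(3) by auto
  then obtain C where "finite C" "K \<subseteq> (\<Union>k\<in>C. {y. y + (n - k) \<in> N})"
    using compactE_image[OF assms(1), of K "\<lambda>k. {y. y + (n - k) \<in> N}"]
      open_translate_vimage[OF assms(2)] by metis
  then show ?thesis
    by (intro that[of "(\<lambda>k. n - k) ` C"]) auto
qed

lemma neighbourhood_diff:
  fixes U :: "'a::topological_ab_group_add set"
  assumes "open U" "0 \<in> U"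
  obtains W where "open W" "0 \<in> W" "\<And>a b. a \<in> W \<Longrightarrow> b \<in> W \<Longrightarrow> a - b \<in> U"
proof -
  have "open ((\<lambda>p. fst p - snd p) -` U :: ('a \<times> 'a) set)"
    using assms(1) by (intro open_vimage continuous_intros)
  moreover have "(0, 0) \<in> (\<lambda>p. fst p - snd p) -` U"
    using assms(2) by simp
  ultimately obtain A B where AB: "open A" "open B" "(0, 0) \<in> A \<times> B"
      "A \<times> B \<subseteq> (\<lambda>p. fst p - snd p) -` U"
    by (rule open_prod_elim)
  show ?thesis
  proof
    show "open (A \<inter> B)" "0 \<in> A \<inter> B"
      using AB by auto
    show "a - b \<in> U" if "a \<in> A \<inter> B" "b \<in> A \<inter> B" for a b
    proof -
      have "(a, b) \<in> A \<times> B"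
        using that by simp
      then show ?thesis
        using AB(4) by auto
    qed
  qed
qed

lemma compact_neighbourhood:
  assumes "locally_compact_space (euclidean :: 'a::topological_space topology)"
  shows "\<exists>U D. open U \<and> x \<in> U \<and> compact (D :: 'a set) \<and> U \<subseteq> D"
proof -
  have "x \<in> topspace euclidean"
    by simp
  then show ?thesis
    using assms unfolding locally_compact_space_def by fastforce
qed

text \<open>The Haar integral as a functional on the functions \<open>bcs\<close>.\<close>

locale invariant_integral =
  fixes I :: "('a::{topological_ab_group_add, t2_space} \<Rightarrow> real) \<Rightarrow> real"
  assumes add: "bcs f \<Longrightarrow> bcs g \<Longrightarrow> I (\<lambda>x. f x + g x) = I f + I g"
    and scale: "bcs f \<Longrightarrow> I (\<lambda>x. c * f x) = c * I f"
    and nonneg: "bcs f \<Longrightarrow> (\<And>x. 0 \<le> f x) \<Longrightarrow> 0 \<le> I f"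
    and shift: "bcs f \<Longrightarrow> I (\<lambda>x. f (x + a)) = I f"
    and nontrivial: "\<exists>f. bcs f \<and> 0 < I f"

text \<open>Let \<open>Z\<close> be a maximal set whose distinct points differ by no element of a neighbourhood \<open>U\<close> of 0.
  Summation over \<open>Z\<close> is almost invariant: a translate of a compact set contains a bounded number of
  points of \<open>Z\<close>, because small sets contain at most one, and every translate of a symmetric
  compact set that contains \<open>U\<close> contains at least one, by maximality. Hence \<open>x \<mapsto> \<Sum>z\<in>Z. h (z + x)\<close> is
  bounded for each \<open>h\<close>, and at least 1 for one particular \<open>h\<close>. An invariant mean of this function of
  \<open>x\<close> is an exactly invariant, nonzero integral.\<close>

lemma exists_invariant_integral:
  assumes "locally_compact_space (euclidean :: 'a::{topological_ab_group_add, t2_space} topology)"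
  shows "\<exists>I :: ('a::{topological_ab_group_add, t2_space} \<Rightarrow> real) \<Rightarrow> real. invariant_integral I"
proof -
  obtain U D :: "'a set" where U: "open U" "0 \<in> U" and D: "compact D" "U \<subseteq> D"
    using compact_neighbourhood[OF assms] by blast
  obtain W where W: "open W" "0 \<in> W" "\<And>a b. a \<in> W \<Longrightarrow> b \<in> W \<Longrightarrow> a - b \<in> U"
    using neighbourhood_diff[OF U] by blast
  define separated where "separated = {Z. \<forall>z\<in>Z. \<forall>w\<in>Z. z \<noteq> w \<longrightarrow> z - w \<notin> U}"
  have "\<exists>Z\<in>separated. \<forall>Y\<in>separated. Z \<subseteq> Y \<longrightarrow> Y = Z"
  proof (rule subset_Zorn_nonempty)
    show "separated \<noteq> {}"
      by (auto simp: separated_def)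
    fix C assume C: "subset.chain separated C"
    show "\<Union>C \<in> separated"
      unfolding separated_def
    proof (clarify)
      fix z w X Y assume *: "z \<in> X" "X \<in> C" "w \<in> Y" "Y \<in> C" "z \<noteq> w" "z - w \<in> U"
      have "X \<subseteq> Y \<or> Y \<subseteq> X"
        using C *(2,4) unfolding subset_chain_def by blast
      then obtain V where "V \<in> C" "z \<in> V" "w \<in> V"
        using * by blast
      moreover have "V \<in> separated"
        using C \<open>V \<in> C\<close> unfolding subset_chain_def by blast
      ultimately show False
        using * unfolding separated_def by blast
    qed
  qed
  then obtain Z where Zsep: "Z \<in> separated"
    and max: "\<And>Y. Y \<in> separated \<Longrightarrow> Z \<subseteq> Y \<Longrightarrow> Y = Z"
    by blast
  have sep: "z = w" if "z \<in> Z" "w \<in> Z" "z - w \<in> U" for z w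
    using Zsep that by (auto simp: separated_def)
  define D' where "D' = D \<union> uminus ` D"
  have D': "compact D'"
    unfolding D'_def using D(1)
    by (intro compact_Un compact_continuous_image continuous_intros)
  have meets: "\<exists>z\<in>Z. z + x \<in> D'" for x
  proof (cases "- x \<in> Z")
    case True
    then show ?thesis
      using U D by (intro bexI[of _ "- x"]) (auto simp: D'_def)
  next
    case False
    then have "insert (- x) Z \<notin> separated"
      using max by blast
    then obtain z where z: "z \<in> Z" "z + x \<in> U \<or> - x - z \<in> U"
      using Zsep unfolding separated_def by auto
    have "z + x \<in> D'" if "- x - z \<in> U"
    proof -
      have "- (- x - z) \<in> uminus ` D"
        using that D(2) by blast
      then show ?thesis
        by (simp add: D'_def add.commute)
    qed
    then show ?thesis
      using z D(2) by (auto simp: D'_def)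
  qed
  have card: "\<exists>n. \<forall>x. finite {z\<in>Z. z + x \<in> K} \<and> card {z\<in>Z. z + x \<in> K} \<le> n"
    if K: "compact K" for K
  proof -
    obtain T where T: "finite T" "\<And>x. x \<in> K \<Longrightarrow> \<exists>t\<in>T. x + t \<in> W"
      using finite_cover_translates[OF K W(1,2)] by blast
    show ?thesis
    proof (intro exI[of _ "card T"] allI)
      fix x
      define A where "A = {z\<in>Z. z + x \<in> K}"
      have "\<forall>z\<in>A. \<exists>t\<in>T. z + x + t \<in> W"
        using T(2) by (auto simp: A_def)
      then obtain \<tau> where \<tau>: "\<And>z. z \<in> A \<Longrightarrow> \<tau> z \<in> T \<and> z + x + \<tau> z \<in> W"
        by metis
      have "inj_on \<tau> A"
      proof (rule inj_onI)
        fix z w assume zw: "z \<in> A" "w \<in> A" "\<tau> z = \<tau> w"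
        have "(z + x + \<tau> z) - (w + x + \<tau> w) \<in> U"
          using W(3) \<tau> zw by blast
        then have "z - w \<in> U"
          using zw by simp
        then show "z = w"
          using sep zw by (auto simp: A_def)
      qed
      moreover have "\<tau> ` A \<subseteq> T"
        using \<tau> by blast
      ultimately show "finite A \<and> card A \<le> card T"
        using T(1) by (meson card_inj_on_le inj_on_finite)
    qed
  qed
  define J :: "('a \<Rightarrow> real) \<Rightarrow> 'a \<Rightarrow> real" where
    "J h = (\<lambda>x. \<Sum>z\<in>{z\<in>Z. h (z + x) \<noteq> 0}. h (z + x))" for h
  have J_eq: "J h x = (\<Sum>z\<in>{z\<in>Z. z + x \<in> K}. h (z + x))"
    if "compact K" "\<And>x. x \<notin> K \<Longrightarrow> h x = 0" for h K x
    unfolding J_def using card[OF that(1)] that(2)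
    by (intro sum.mono_neutral_left) auto
  have J_bd: "bounded (range (J h))" if h: "bcs h" for h
  proof -
    obtain K B where K: "compact K" "\<And>x. x \<notin> K \<Longrightarrow> h x = 0"
      and B: "\<And>x. norm (h x) \<le> B" "0 < B"
      using h by (rule bcsE) blast
    obtain n where n: "\<And>x. finite {z\<in>Z. z + x \<in> K}" "\<And>x. card {z\<in>Z. z + x \<in> K} \<le> n"
      using card[OF K(1)] by blast
    have "norm (J h x) \<le> real n * B" for x
    proof -
      have "norm (J h x) \<le> real (card {z\<in>Z. z + x \<in> K}) * B"
        using order_trans[OF norm_sum sum_bounded_above, OF B(1)] J_eq[of K h, OF K] by simp
      also have "\<dots> \<le> real n * B"
        using n(2) B(2) by (intro mult_right_mono) auto
      finally show ?thesis .
    qed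
    then show ?thesis
      by (auto simp: bounded_range_iff)
  qed
  obtain m :: "('a \<Rightarrow> real) \<Rightarrow> real" where m: "mean m"
    and inv: "\<And>f a. bounded (range f) \<Longrightarrow> m (\<lambda>x. f (x + a)) = m f"
    using exists_invariant_mean by blast
  have "invariant_integral (\<lambda>h. m (J h))"
  proof
    fix f g :: "'a \<Rightarrow> real" and c a
    assume f: "bcs f"
    obtain K where K: "compact K" "\<And>x. x \<notin> K \<Longrightarrow> f x = 0"
      using f by (rule bcsE) blast
    have "J (\<lambda>x. c * f x) = (\<lambda>x. c * J f x)"
    proof
      fix x
      have "J (\<lambda>x. c * f x) x = (\<Sum>z\<in>{z\<in>Z. z + x \<in> K}. c * f (z + x))"
        using K by (intro J_eq) auto
      also have "\<dots> = c * J f x"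
        using J_eq[of K f, OF K] by (simp add: sum_distrib_left)
      finally show "J (\<lambda>x. c * f x) x = c * J f x" .
    qed
    then show "m (J (\<lambda>x. c * f x)) = c * m (J f)"
      using mean_scale[OF m J_bd[OF f]] by simp
    show "0 \<le> m (J f)" if "\<And>x. 0 \<le> f x"
    proof (rule mean_nonneg[OF m J_bd[OF f]])
      show "0 \<le> J f x" for x
        using that by (simp add: J_def sum_nonneg)
    qed
    have "J (\<lambda>x. f (x + a)) = (\<lambda>x. J f (x + a))"
      by (simp add: J_def add.assoc)
    then show "m (J (\<lambda>x. f (x + a))) = m (J f)"
      using inv[OF J_bd[OF f]] by simp
    assume g: "bcs g"
    obtain L where L: "compact L" "\<And>x. x \<notin> L \<Longrightarrow> g x = 0"
      using g by (rule bcsE) blast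
    have "J (\<lambda>x. f x + g x) = (\<lambda>x. J f x + J g x)"
    proof
      fix x
      have KL: "compact (K \<union> L)"
        using K(1) L(1) by (rule compact_Un)
      have "\<And>x. x \<notin> K \<union> L \<Longrightarrow> f x = 0" "\<And>x. x \<notin> K \<union> L \<Longrightarrow> g x = 0"
        "\<And>x. x \<notin> K \<union> L \<Longrightarrow> f x + g x = 0"
        using K(2) L(2) by auto
      note this[THEN J_eq[of "K \<union> L", OF KL]]
      then show "J (\<lambda>x. f x + g x) x = J f x + J g x"
        by (simp add: sum.distrib)
    qed
    then show "m (J (\<lambda>x. f x + g x)) = m (J f) + m (J g)"
      using mean_add[OF m J_bd[OF f] J_bd[OF g]] by simp
  next
    define h :: "'a \<Rightarrow> real" where "h = indicator D'"
    have h: "bcs h"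
      unfolding h_def by (rule bcs_indicator[OF D'])
    have "1 \<le> J h x" for x
    proof -
      obtain z where z: "z \<in> Z" "z + x \<in> D'"
        using meets by blast
      have "h (z + x) \<le> (\<Sum>z\<in>{z\<in>Z. z + x \<in> D'}. h (z + x))"
        using z card[OF D'] by (intro member_le_sum) (auto simp: h_def)
      also have "\<dots> = J h x"
        by (rule J_eq[symmetric, OF D']) (simp add: h_def)
      finally show ?thesis
        using z by (simp add: h_def)
    qed
    then have "0 \<le> m (\<lambda>x. J h x + (- 1) * 1)"
      using bounded_range_add[OF J_bd[OF h] bounded_range_const[of "- 1"]] by (intro mean_nonneg[OF m]) simp_all
    also have "m (\<lambda>x. J h x + (- 1) * 1) = m (J h) + (- 1) * 1"
      using mean_add[OF m J_bd[OF h] bounded_range_const[of "(- 1) * 1"]]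
        mean_scale[OF m bounded_range_const[of 1], of "- 1"] mean_one[OF m] by simp
    finally have "0 < m (J h)"
      by simp
    then show "\<exists>f. bcs f \<and> 0 < m (J f)"
      using h by blast
  qed
  then show ?thesis
    by blast
qed

context invariant_integral
begin

lemma diff: "bcs f \<Longrightarrow> bcs g \<Longrightarrow> I (\<lambda>x. f x - g x) = I f - I g"
  using add[of f "\<lambda>x. - 1 * g x"] scale[of g "-1"] bcs_scale[of g "-1"] by simp

lemma mono: "bcs f \<Longrightarrow> bcs g \<Longrightarrow> (\<And>x. f x \<le> g x) \<Longrightarrow> I f \<le> I g"
  using nonneg[OF bcs_diff[of g f]] diff[of g f] by simp

lemma zero: "I (\<lambda>x. 0) = 0"
  using scale[OF bcs_zero, of 0] by simp

lemma sum: "finite A \<Longrightarrow> (\<And>i. i \<in> A \<Longrightarrow> bcs (f i)) \<Longrightarrow> I (\<lambda>x. \<Sum>i\<in>A. f i x) = (\<Sum>i\<in>A. I (f i))"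
  by (induction A rule: finite_induct) (simp_all add: zero add bcs_sum)

text \<open>Finitely many translates of a multiple of \<open>h\<close> dominate a function of positive integral.\<close>

lemma positive_on_open:
  assumes h: "bcs h" "\<And>x. 0 \<le> h x" and N: "open N" "n \<in> N"
    and c: "0 < c" "\<And>x. x \<in> N \<Longrightarrow> c \<le> h x"
  shows "0 < I h"
proof -
  obtain f where f: "bcs f" "0 < I f"
    using nontrivial by blast
  obtain K B where K: "compact K" "\<And>x. x \<notin> K \<Longrightarrow> f x = 0" and B: "\<And>x. norm (f x) \<le> B" "0 < B"
    using f(1) by (rule bcsE) blast
  obtain T where T: "finite T" "\<And>x. x \<in> K \<Longrightarrow> \<exists>t\<in>T. x + t \<in> N"
    using finite_cover_translates[OF K(1) N] by blast
  have "f x \<le> B / c * (\<Sum>t\<in>T. h (x + t))" for x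
  proof (cases "x \<in> K")
    case True
    then obtain t where t: "t \<in> T" "x + t \<in> N"
      using T(2) by blast
    have "c \<le> h (x + t)"
      using c(2) t(2) .
    also have "\<dots> \<le> (\<Sum>t\<in>T. h (x + t))"
      using t(1) T(1) h(2) by (intro member_le_sum)
    finally have "B / c * c \<le> B / c * (\<Sum>t\<in>T. h (x + t))"
      using B(2) c(1) by (intro mult_left_mono) auto
    then show ?thesis
      using B(1)[of x] c(1) by simp
  next
    case False
    then show ?thesis
      using K(2) B(2) c(1) h(2) by (simp add: sum_nonneg)
  qed
  then have "I f \<le> I (\<lambda>x. B / c * (\<Sum>t\<in>T. h (x + t)))"
    by (intro mono f bcs_scale bcs_sum T(1) bcs_shift h)
  also have "\<dots> = B / c * (real (card T) * I h)"
  proof -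
    have "bcs (\<lambda>x. \<Sum>t\<in>T. h (x + t))"
      by (intro bcs_sum T(1) bcs_shift h)
    moreover have "I (\<lambda>x. \<Sum>t\<in>T. h (x + t)) = (\<Sum>t\<in>T. I h)"
      using T(1) by (simp add: sum bcs_shift shift h(1))
    ultimately show ?thesis
      using scale[of "\<lambda>x. \<Sum>t\<in>T. h (x + t)" "B / c"] by simp
  qed
  finally have "I h \<noteq> 0"
    using f(2) by auto
  then show ?thesis
    using nonneg[OF h] by simp
qed

text \<open>Uniform continuity on a compact set, from the tube lemma. For \<open>y\<close> in a compact neighbourhood of 0
  the integrand lives on one compact set, so a uniform bound suffices.\<close>

lemma translation_tendsto_zero:
  assumes lc: "locally_compact_space (euclidean :: 'a topology)"
    and f: "bcs f" "continuous_on UNIV f"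
  shows "((\<lambda>y. I (\<lambda>x. \<bar>f (x - y) - f x\<bar>)) \<longlongrightarrow> 0) (nhds 0)"
proof (rule tendstoI)
  fix e :: real assume e: "0 < e"
  obtain U D :: "'a set" where U: "open U" "0 \<in> U" and D: "compact D" "U \<subseteq> D"
    using compact_neighbourhood[OF lc] by blast
  obtain K where K: "compact K" "\<And>x. x \<notin> K \<Longrightarrow> f x = 0"
    using f(1) by (rule bcsE) blast
  \<comment> \<open>\<open>L\<close> contains the support of the integrand for all \<open>y\<close> in \<open>D\<close>.\<close>
  define L where "L = (\<lambda>p. fst p + snd p) ` (K \<times> D)"
  have L: "compact L"
    unfolding L_def using K(1) D(1)
    by (intro compact_continuous_image compact_Times continuous_intros)
  have L_add: "x + y \<in> L" if "x \<in> K" "y \<in> D" for x y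
    unfolding L_def using that by (intro image_eqI[of _ _ "(x, y)"]) auto
  define c where "c = I (indicator L)"
  have c: "0 \<le> c"
    unfolding c_def by (intro nonneg bcs_indicator L) simp
  define d where "d = e / (c + 1)"
  have d: "0 < d" "d * c < e"
    using e c by (auto simp: d_def field_simps)
  define W :: "('a \<times> 'a) set" where "W = {p. \<bar>f (snd p - fst p) - f (snd p)\<bar> < d}"
  have "open W"
    unfolding W_def
    by (intro open_Collect_less continuous_intros continuous_on_compose2[OF f(2)]) auto
  moreover have "{0} \<times> L \<subseteq> W"
    using d by (auto simp: W_def)
  ultimately have "\<exists>X. 0 \<in> X \<and> open X \<and> X \<times> L \<subseteq> W"
    by (rule Elementary_Topology.tube_lemma[OF L])
  then obtain X where X: "0 \<in> X" "open X" "X \<times> L \<subseteq> W"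
    by blast
  have "I (\<lambda>x. \<bar>f (x - y) - f x\<bar>) < e" if y: "y \<in> X \<inter> U" for y
  proof -
    have "\<bar>f (x - y) - f x\<bar> \<le> d * indicator L x" for x
    proof (cases "x \<in> L")
      case True
      then have "(y, x) \<in> W"
        using y X(3) by blast
      then show ?thesis
        using True by (simp add: W_def)
    next
      case False
      have "x \<notin> K"
        using False L_add[of x 0] U(2) D(2) by auto
      moreover have "x - y \<notin> K"
        using False L_add[of "x - y" y] y D(2) by auto
      ultimately show ?thesis
        using K(2) d(1) by simp
    qed
    then have "I (\<lambda>x. \<bar>f (x - y) - f x\<bar>) \<le> I (\<lambda>x. d * indicator L x)"
      using bcs_shift[OF f(1), of "- y"]
      by (intro mono bcs_abs bcs_diff bcs_scale bcs_indicator L f(1)) simp_all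
    also have "\<dots> = d * c"
      by (simp add: scale bcs_indicator L c_def)
    finally show ?thesis
      using d(2) by simp
  qed
  moreover have "0 \<le> I (\<lambda>x. \<bar>f (x - y) - f x\<bar>)" for y
    using bcs_shift[OF f(1), of "- y"]
    by (intro nonneg bcs_abs bcs_diff f(1)) simp_all
  ultimately show "\<forall>\<^sub>F y in nhds 0. dist (I (\<lambda>x. \<bar>f (x - y) - f x\<bar>)) 0 < e"
    unfolding eventually_nhds using X U by (intro exI[of _ "X \<inter> U"]) (auto simp: dist_real_def)
qed

definition Ic :: "('a \<Rightarrow> complex) \<Rightarrow> complex" where
  "Ic h = Complex (I (\<lambda>x. Re (h x))) (I (\<lambda>x. Im (h x)))"

lemma Ic_add: "bcs f \<Longrightarrow> bcs g \<Longrightarrow> Ic (\<lambda>x. f x + g x) = Ic f + Ic g"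
  by (simp add: Ic_def add bcs_Re bcs_Im complex_eq_iff)

lemma Ic_scale: "bcs f \<Longrightarrow> Ic (\<lambda>x. c * f x) = c * Ic f"
  by (simp add: Ic_def add diff scale bcs_Re bcs_Im bcs_scale complex_eq_iff)

lemma Ic_diff: "bcs f \<Longrightarrow> bcs g \<Longrightarrow> Ic (\<lambda>x. f x - g x) = Ic f - Ic g"
  by (simp add: Ic_def diff bcs_Re bcs_Im complex_eq_iff)

lemma Ic_shift: "bcs f \<Longrightarrow> Ic (\<lambda>x. f (x + a)) = Ic f"
  using shift[OF bcs_Re] shift[OF bcs_Im] by (simp add: Ic_def)

lemma Ic_cnj: "bcs f \<Longrightarrow> Ic (\<lambda>x. cnj (f x)) = cnj (Ic f)"
  using scale[OF bcs_Im, of f "-1"] by (simp add: Ic_def complex_eq_iff)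

lemma Ic_of_real: "Ic (\<lambda>x. complex_of_real (f x)) = of_real (I f)"
  by (simp add: Ic_def zero complex_eq_iff)

text \<open>Rotate \<open>Ic h\<close> to the positive real axis and compare real parts.\<close>

lemma norm_Ic_le:
  assumes h: "bcs h" and k: "bcs k" and le: "\<And>x. norm (h x) \<le> k x"
  shows "norm (Ic h) \<le> I k"
proof (cases "Ic h = 0")
  case True
  have "0 \<le> k x" for x
    using le[of x] norm_ge_zero order_trans by blast
  then show ?thesis
    using nonneg[OF k] True by simp
next
  case False
  define e where "e = cnj (Ic h) / norm (Ic h)"
  have e: "norm e = 1"
    using False by (simp add: e_def norm_divide)
  have "e * Ic h = norm (Ic h)"
    using False by (simp add: e_def complex_norm_square[symmetric] mult.commute power2_eq_square)
  then have "norm (Ic h) = Re (e * Ic h)"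
    by simp
  also have "\<dots> = I (\<lambda>x. Re (e * h x))"
    using Ic_scale[OF h, of e] by (metis Ic_def complex.sel(1))
  also have "\<dots> \<le> I k"
  proof (intro mono bcs_Re bcs_scale h k)
    fix x
    have "Re (e * h x) \<le> norm (h x)"
      using complex_Re_le_cmod[of "e * h x"] e by (simp add: norm_mult)
    then show "Re (e * h x) \<le> k x"
      using le[of x] by simp
  qed
  finally show ?thesis .
qed

end

section \<open>Characters as extreme points\<close>

text \<open>On a character \<open>\<gamma>\<close> this is multiplication by \<open>\<bar>1 + e \<gamma>(a)\<bar>\<^sup>2 / 4\<close>, a number in \<open>[0, 1]\<close>. The factors
  for \<open>e\<close> and \<open>- e\<close> add up to 1, so \<open>square_conv e a\<close> and \<open>square_conv (- e) a\<close> split a function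
  into two parts; at an extreme point the parts must be proportional to the whole.\<close>

definition square_conv :: "complex \<Rightarrow> 'a::ab_group_add \<Rightarrow> ('a \<Rightarrow> complex) \<Rightarrow> 'a \<Rightarrow> complex" where
  "square_conv e a \<phi> = (\<lambda>x. (2 * \<phi> x + e * \<phi> (x + a) + cnj e * \<phi> (x - a)) / 4)"

text \<open>Compositions of these operators are the only positivity tests that are used. Positivity of
  \<open>R \<phi> 0\<close> for all \<open>R\<close> in this class replaces positive definiteness, and it is inherited by
  \<open>square_conv e a \<phi>\<close> because the class is closed under composition.\<close>

inductive_set square_ops :: "(('a::ab_group_add \<Rightarrow> complex) \<Rightarrow> 'a \<Rightarrow> complex) set" where
  ident: "(\<lambda>\<phi>. \<phi>) \<in> square_ops"
| comp: "R \<in> square_ops \<Longrightarrow> norm e = 1 \<Longrightarrow> (\<lambda>\<phi>. R (square_conv e a \<phi>)) \<in> square_ops"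

lemma square_conv_scale: "square_conv e a (\<lambda>x. c * \<phi> x) = (\<lambda>x. c * square_conv e a \<phi> x)"
  by (simp add: square_conv_def algebra_simps)

lemma square_ops_scale:
  "R \<in> square_ops \<Longrightarrow> R (\<lambda>x. c * \<phi> x) = (\<lambda>x. c * R \<phi> x)"
  by (induction R arbitrary: \<phi> rule: square_ops.induct) (simp_all add: square_conv_scale)

lemma continuous_on_square_ops:
  assumes "R \<in> square_ops"
  shows "continuous_on UNIV (\<lambda>\<phi>. R \<phi> x)"
  using assms
proof (induction R arbitrary: x rule: square_ops.induct)
  case (comp R e a)
  have "continuous_on UNIV (square_conv e a)"
    unfolding square_conv_def
    by (intro continuous_on_coordinatewise_then_product continuous_intros) simp_all
  then show ?case
    by (intro continuous_on_compose2[OF comp.IH]) auto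
qed simp

text \<open>Here \<open>\<phi> = fst \<circ> p\<close> is of positive type, and \<open>\<psi> = snd \<circ> p\<close> and its increments \<open>\<psi>(\<cdot> + y) - \<psi>\<close> are
  controlled by \<open>\<phi>\<close>. The second function carries the continuity: \<open>\<phi>\<close> may be discontinuous, and a
  pointwise limit of continuous functions may be so too, but the modulus \<open>\<omega>\<close> survives both pointwise
  limits and the operators.\<close>

definition dominated_pairs ::
    "real \<Rightarrow> ('a::ab_group_add \<Rightarrow> real) \<Rightarrow> ('a \<Rightarrow> complex \<times> complex) set" where
  "dominated_pairs C \<omega> = {p. (\<forall>x. fst (p (- x)) = cnj (fst (p x))) \<and>
     (\<forall>R\<in>square_ops. 0 \<le> Re (R (\<lambda>x. fst (p x)) 0) \<and>
        norm (R (\<lambda>x. snd (p x)) 0) \<le> C * Re (R (\<lambda>x. fst (p x)) 0) \<and>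
        (\<forall>y. norm (R (\<lambda>x. snd (p x)) y - R (\<lambda>x. snd (p x)) 0)
            \<le> \<omega> y * Re (R (\<lambda>x. fst (p x)) 0)))}"

lemma dominated_pairsD:
  assumes "p \<in> dominated_pairs C \<omega>"
  shows "fst (p (- x)) = cnj (fst (p x))"
    "R \<in> square_ops \<Longrightarrow> 0 \<le> Re (R (\<lambda>x. fst (p x)) 0)"
    "R \<in> square_ops \<Longrightarrow> norm (R (\<lambda>x. snd (p x)) 0) \<le> C * Re (R (\<lambda>x. fst (p x)) 0)"
    "R \<in> square_ops \<Longrightarrow> norm (R (\<lambda>x. snd (p x)) y - R (\<lambda>x. snd (p x)) 0)
            \<le> \<omega> y * Re (R (\<lambda>x. fst (p x)) 0)"
  using assms unfolding dominated_pairs_def by simp_all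

definition pair_conv where
  "pair_conv e a p = (\<lambda>x. (square_conv e a (\<lambda>x. fst (p x)) x, square_conv e a (\<lambda>x. snd (p x)) x))"

lemma pair_conv_in_dominated_pairs:
  assumes p: "p \<in> dominated_pairs C \<omega>" and e: "norm e = 1"
  shows "pair_conv e a p \<in> dominated_pairs C \<omega>"
  unfolding dominated_pairs_def
proof (intro CollectI conjI allI ballI)
  have herm: "fst (p (- x)) = cnj (fst (p x))" for x
    using p by (rule dominated_pairsD)
  show "fst (pair_conv e a p (- x)) = cnj (fst (pair_conv e a p x))" for x
  proof -
    have "- x + a = - (x - a)" "- x - a = - (x + a)"
      by simp_all
    then have "fst (p (- x + a)) = cnj (fst (p (x - a)))" "fst (p (- x - a)) = cnj (fst (p (x + a)))"
      by (simp_all only: herm)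
    then show ?thesis
      using herm[of x] by (simp add: pair_conv_def square_conv_def)
  qed
  fix R :: "('a \<Rightarrow> complex) \<Rightarrow> 'a \<Rightarrow> complex" assume "R \<in> square_ops"
  then have R: "(\<lambda>\<phi>. R (square_conv e a \<phi>)) \<in> square_ops"
    using e by (rule square_ops.comp)
  show "0 \<le> Re (R (\<lambda>x. fst (pair_conv e a p x)) 0)"
    "norm (R (\<lambda>x. snd (pair_conv e a p x)) 0) \<le> C * Re (R (\<lambda>x. fst (pair_conv e a p x)) 0)"
    "norm (R (\<lambda>x. snd (pair_conv e a p x)) y - R (\<lambda>x. snd (pair_conv e a p x)) 0)
      \<le> \<omega> y * Re (R (\<lambda>x. fst (pair_conv e a p x)) 0)" for y
    using dominated_pairsD(2-4)[OF p R] by (simp_all add: pair_conv_def)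
qed

lemma scale_in_dominated_pairs:
  assumes p: "p \<in> dominated_pairs C \<omega>" and c: "0 \<le> c"
  shows "(\<lambda>x. c *\<^sub>R p x) \<in> dominated_pairs C \<omega>"
  unfolding dominated_pairs_def
proof (intro CollectI conjI allI ballI)
  show "fst (c *\<^sub>R p (- x)) = cnj (fst (c *\<^sub>R p x))" for x
    using p by (simp add: dominated_pairs_def)
  fix R :: "('a \<Rightarrow> complex) \<Rightarrow> 'a \<Rightarrow> complex" assume R: "R \<in> square_ops"
  have *: "R (\<lambda>x. fst (c *\<^sub>R p x)) = (\<lambda>x. of_real c * R (\<lambda>x. fst (p x)) x)"
    "R (\<lambda>x. snd (c *\<^sub>R p x)) = (\<lambda>x. of_real c * R (\<lambda>x. snd (p x)) x)"
    by (simp_all add: scaleR_conv_of_real square_ops_scale[OF R])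
  have p': "0 \<le> Re (R (\<lambda>x. fst (p x)) 0)"
    "norm (R (\<lambda>x. snd (p x)) 0) \<le> C * Re (R (\<lambda>x. fst (p x)) 0)"
    "norm (R (\<lambda>x. snd (p x)) y - R (\<lambda>x. snd (p x)) 0) \<le> \<omega> y * Re (R (\<lambda>x. fst (p x)) 0)" for y
    using dominated_pairsD(2-4)[OF p R] by simp_all
  show "0 \<le> Re (R (\<lambda>x. fst (c *\<^sub>R p x)) 0)"
    using p'(1) c unfolding * by simp
  show "norm (R (\<lambda>x. snd (c *\<^sub>R p x)) 0) \<le> C * Re (R (\<lambda>x. fst (c *\<^sub>R p x)) 0)"
    using mult_left_mono[OF p'(2) c] c unfolding * by (simp add: norm_mult mult_ac)
  show "norm (R (\<lambda>x. snd (c *\<^sub>R p x)) y - R (\<lambda>x. snd (c *\<^sub>R p x)) 0)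
      \<le> \<omega> y * Re (R (\<lambda>x. fst (c *\<^sub>R p x)) 0)" for y
    using mult_left_mono[OF p'(3)[of y] c] c
    unfolding * right_diff_distrib[symmetric] by (simp add: norm_mult mult_ac)
qed

text \<open>The bound on \<open>fst (p x)\<close> is positivity of \<open>square_conv e x\<close> at 0, with the phase \<open>e\<close> for which
  \<open>e * fst (p x)\<close> is a negative real. The others are the defining conditions for the identity operator.\<close>

lemma dominated_pairs_bounds:
  assumes p: "p \<in> dominated_pairs C \<omega>"
  shows "0 \<le> Re (fst (p 0))" "fst (p 0) = of_real (Re (fst (p 0)))"
    "norm (fst (p x)) \<le> Re (fst (p 0))" "norm (snd (p 0)) \<le> C * Re (fst (p 0))"
    "norm (snd (p x) - snd (p 0)) \<le> \<omega> x * Re (fst (p 0))"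
proof -
  show "0 \<le> Re (fst (p 0))" "norm (snd (p 0)) \<le> C * Re (fst (p 0))"
    "norm (snd (p x) - snd (p 0)) \<le> \<omega> x * Re (fst (p 0))"
    by (rule dominated_pairsD(2-4)[OF p square_ops.ident])+
  have herm: "fst (p (- x)) = cnj (fst (p x))" for x
    using p by (rule dominated_pairsD)
  show "fst (p 0) = of_real (Re (fst (p 0)))"
    using herm[of 0] by (simp add: complex_eq_iff)
  show "norm (fst (p x)) \<le> Re (fst (p 0))"
  proof (cases "fst (p x) = 0")
    case True
    then show ?thesis
      using \<open>0 \<le> Re (fst (p 0))\<close> by simp
  next
    case False
    define e where "e = - cnj (fst (p x)) / norm (fst (p x))"
    have e: "norm e = 1"
      using False by (simp add: e_def norm_divide)
    have "fst (p x) * cnj (fst (p x)) = of_real (norm (fst (p x)))^2"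
      by (simp only: complex_norm_square of_real_power[symmetric])
    then have ex: "e * fst (p x) = - of_real (norm (fst (p x)))"
      using False by (simp add: e_def mult.commute power2_eq_square)
    have "0 \<le> Re (square_conv e x (\<lambda>x. fst (p x)) 0)"
      using dominated_pairsD(2)[OF p square_ops.comp[OF square_ops.ident e]] .
    also have "square_conv e x (\<lambda>x. fst (p x)) 0
        = (2 * fst (p 0) + e * fst (p x) + cnj (e * fst (p x))) / 4"
      by (simp add: square_conv_def herm)
    also have "Re \<dots> = (Re (fst (p 0)) - norm (fst (p x))) / 2"
      unfolding ex by simp
    finally show ?thesis
      by simp
  qed
qed

definition normalized_pairs where
  "normalized_pairs C \<omega> = {p \<in> dominated_pairs C \<omega>. fst (p 0) = 1}"

lemma closed_normalized_pairs: "closed (normalized_pairs C \<omega>)"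
proof -
  have ev: "continuous_on UNIV (\<lambda>p. fst (p x :: complex \<times> complex))"
    "continuous_on UNIV (\<lambda>p. snd (p x :: complex \<times> complex))" for x :: 'a
    by (intro continuous_intros; simp)+
  have R: "continuous_on UNIV (\<lambda>p. R (\<lambda>x. fst (p x :: complex \<times> complex)) y)"
    "continuous_on UNIV (\<lambda>p. R (\<lambda>x. snd (p x :: complex \<times> complex)) y)"
    if "R \<in> square_ops" for R :: "('a \<Rightarrow> complex) \<Rightarrow> 'a \<Rightarrow> complex" and y
    by (rule continuous_on_compose2[OF continuous_on_square_ops[OF that] _ subset_UNIV];
        intro continuous_on_coordinatewise_then_product ev)+
  have "normalized_pairs C \<omega> = {p. fst (p 0) = 1} \<inter> (\<Inter>x. {p. fst (p (- x)) = cnj (fst (p x))})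
      \<inter> (\<Inter>R\<in>square_ops. {p. 0 \<le> Re (R (\<lambda>x. fst (p x)) 0)}
          \<inter> {p. norm (R (\<lambda>x. snd (p x)) 0) \<le> C * Re (R (\<lambda>x. fst (p x)) 0)}
          \<inter> (\<Inter>y. {p. norm (R (\<lambda>x. snd (p x)) y - R (\<lambda>x. snd (p x)) 0)
              \<le> \<omega> y * Re (R (\<lambda>x. fst (p x)) 0)}))"
    unfolding normalized_pairs_def dominated_pairs_def by auto
  also have "closed \<dots>"
    by (intro closed_Int closed_INT ballI closed_Collect_eq closed_Collect_le continuous_on_norm
        continuous_on_diff continuous_on_mult continuous_on_Re continuous_on_cnj continuous_on_const ev R)
  finally show ?thesis .
qed

lemma compact_normalized_pairs: "compact (normalized_pairs C \<omega>)"
proof -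
  define B :: "('a \<Rightarrow> complex \<times> complex) set"
    where "B = {p. \<forall>x. p x \<in> cball 0 1 \<times> cball 0 (C + \<omega> x)}"
  have "compact B"
    unfolding B_def by (intro compact_box compact_Times compact_cball)
  moreover have "p \<in> B" if "p \<in> normalized_pairs C \<omega>" for p
  proof -
    have p: "p \<in> dominated_pairs C \<omega>" and p0: "fst (p 0) = 1"
      using that by (auto simp: normalized_pairs_def)
    have "norm (fst (p x)) \<le> 1" "norm (snd (p x)) \<le> C + \<omega> x" for x
      using dominated_pairs_bounds(3,5)[OF p, of x] dominated_pairs_bounds(4)[OF p] p0 norm_triangle_sub[of "snd (p x)" "snd (p 0)"]
      by auto
    then show ?thesis
      by (simp add: B_def mem_Times_iff)
  qed
  then have "normalized_pairs C \<omega> = B \<inter> normalized_pairs C \<omega>"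
    by blast
  ultimately show ?thesis
    using compact_Int_closed closed_normalized_pairs by metis
qed

lemma dominated_pairs_eq_0:
  assumes p: "p \<in> dominated_pairs C \<omega>" and "Re (fst (p 0)) = 0"
  shows "p x = 0"
  using dominated_pairs_bounds(3,5)[OF p, of x] dominated_pairs_bounds(4)[OF p] assms(2) by (auto simp: prod_eq_iff)

definition extreme_pair :: "real \<Rightarrow> ('a::ab_group_add \<Rightarrow> real) \<Rightarrow> ('a \<Rightarrow> complex \<times> complex) \<Rightarrow> bool" where
  "extreme_pair C \<omega> p \<longleftrightarrow> p \<in> normalized_pairs C \<omega> \<and>
     (\<forall>q\<in>normalized_pairs C \<omega>. \<forall>r\<in>normalized_pairs C \<omega>. \<forall>t. 0 < t \<longrightarrow> t < 1 \<longrightarrow>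
        p = (\<lambda>x. t *\<^sub>R q x + (1 - t) *\<^sub>R r x) \<longrightarrow> q = p)"

text \<open>The pair is the sum of its images \<open>q\<close> and \<open>r\<close> under the operators for \<open>e\<close> and \<open>- e\<close>, and both images are
  dominated pairs. After normalisation this is a convex combination with weight \<open>t = Re (fst (q 0))\<close>,
  so extremality gives \<open>q = t p\<close>; at the ends \<open>t = 0\<close> and \<open>t = 1\<close> one of the two images vanishes.\<close>

lemma extreme_pair_eigenvector:
  assumes extreme: "extreme_pair C \<omega> p"
    and e: "norm e = 1"
  shows "pair_conv e a p x = Re (fst (pair_conv e a p 0)) *\<^sub>R p x"
proof -
  have p: "p \<in> normalized_pairs C \<omega>"
    using extreme by (simp add: extreme_pair_def)
  define q where "q = pair_conv e a p"
  define r where "r = pair_conv (- e) a p"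
  define t where "t = Re (fst (q 0))"
  have q: "q \<in> dominated_pairs C \<omega>" and r: "r \<in> dominated_pairs C \<omega>"
    unfolding q_def r_def using p e by (auto simp: normalized_pairs_def intro: pair_conv_in_dominated_pairs)
  have sum: "q x + r x = p x" for x
    by (simp add: q_def r_def pair_conv_def square_conv_def prod_eq_iff field_simps)
  have p0: "fst (p 0) = 1"
    using p by (simp add: normalized_pairs_def)
  have r0: "Re (fst (r 0)) = 1 - t"
    using arg_cong[OF sum[of 0], of "\<lambda>z. Re (fst z)"] p0 by (simp add: t_def)
  have t01: "0 \<le> t" "t \<le> 1"
    using dominated_pairs_bounds(1)[OF q] dominated_pairs_bounds(1)[OF r] r0 by (auto simp: t_def)
  consider "t = 0" | "t = 1" | "0 < t" "t < 1"
    using t01 by linarith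
  then have "q x = t *\<^sub>R p x"
  proof cases
    case 1
    then show ?thesis
      using dominated_pairs_eq_0[OF q] by (simp add: t_def)
  next
    case 2
    then show ?thesis
      using dominated_pairs_eq_0[OF r] r0 sum[of x] by simp
  next
    case 3
    define q' where "q' = (\<lambda>x. (1 / t) *\<^sub>R q x)"
    define r' where "r' = (\<lambda>x. (1 / (1 - t)) *\<^sub>R r x)"
    have "fst (q 0) = of_real t" "fst (r 0) = of_real (1 - t)"
      using dominated_pairs_bounds(2)[OF q] dominated_pairs_bounds(2)[OF r] r0 t_def by metis+
    then have "q' \<in> normalized_pairs C \<omega>" "r' \<in> normalized_pairs C \<omega>"
      unfolding normalized_pairs_def q'_def r'_def
      using 3 scale_in_dominated_pairs[OF q] scale_in_dominated_pairs[OF r]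
      by (auto simp: scaleR_conv_of_real)
    moreover have "p = (\<lambda>x. t *\<^sub>R q' x + (1 - t) *\<^sub>R r' x)"
      using 3 by (simp add: q'_def r'_def sum)
    ultimately have "q' = p"
      using extreme 3 unfolding extreme_pair_def by blast
    then show ?thesis
      using 3 by (auto simp: q'_def)
  qed
  then show ?thesis
    by (simp add: q_def t_def)
qed

text \<open>An eigenvector of all \<open>square_conv e a\<close>, with eigenvalue given by its value at 0: comparing the phases
  \<open>e = 1\<close> and \<open>e = \<i>\<close> isolates the translate by \<open>a\<close> and gives multiplicativity.\<close>

lemma extreme_pair_multiplicative:
  assumes extreme: "extreme_pair C \<omega> p"
  shows "fst (p (x + y)) = fst (p x) * fst (p y)" "norm (fst (p x)) = 1"
    "snd (p x) = fst (p x) * snd (p 0)"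
proof -
  have p: "p \<in> normalized_pairs C \<omega>"
    using extreme by (simp add: extreme_pair_def)
  then have dom: "p \<in> dominated_pairs C \<omega>" and p0: "fst (p 0) = 1"
    using p by (auto simp: normalized_pairs_def)
  define \<phi> where "\<phi> x = fst (p x)" for x
  define \<psi> where "\<psi> x = snd (p x)" for x
  have \<phi>0: "\<phi> 0 = 1"
    using p0 by (simp add: \<phi>_def)
  have eig: "square_conv e a \<phi> x = square_conv e a \<phi> 0 * \<phi> x"
    "square_conv e a \<psi> x = square_conv e a \<phi> 0 * \<psi> x" if e: "norm e = 1" for e a x
  proof -
    define t where "t = Re (fst (pair_conv e a p 0))"
    have "pair_conv e a p x = t *\<^sub>R p x" for x
      unfolding t_def by (rule extreme_pair_eigenvector[OF extreme e])
    then have *: "square_conv e a \<phi> x = of_real t * \<phi> x" "square_conv e a \<psi> x = of_real t * \<psi> x" for x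
      by (simp_all add: pair_conv_def \<phi>_def[abs_def] \<psi>_def[abs_def] prod_eq_iff scaleR_conv_of_real)
    from this(1)[of 0] show "square_conv e a \<phi> x = square_conv e a \<phi> 0 * \<phi> x"
      "square_conv e a \<psi> x = square_conv e a \<phi> 0 * \<psi> x"
      using * \<phi>0 by simp_all
  qed
  have mult: "h (x + a) = \<phi> a * h x"
    if eq: "\<And>e. norm e = 1 \<Longrightarrow> square_conv e a h x = square_conv e a \<phi> 0 * h x" for h a x
  proof -
    have *: "2 * h x + e * h (x + a) + cnj e * h (x - a) = (2 + e * \<phi> a + cnj e * \<phi> (- a)) * h x"
      if "norm e = 1" for e
      using eq[OF that] unfolding square_conv_def
      by (simp only: times_divide_eq_left divide_cancel_right zero_neq_numeral[symmetric] simp_thms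
          \<phi>0 mult_1_right add_0_left diff_0)
    have "h (x + a) + h (x - a) = (\<phi> a + \<phi> (- a)) * h x"
      using *[of 1] by (simp add: algebra_simps)
    moreover have "\<i> * (h (x + a) - h (x - a)) = \<i> * ((\<phi> a - \<phi> (- a)) * h x)"
      using *[of \<i>] by (simp add: algebra_simps)
    then have "h (x + a) - h (x - a) = (\<phi> a - \<phi> (- a)) * h x"
      by (subst (asm) mult_left_cancel) simp_all
    ultimately have "(h (x + a) + h (x - a)) + (h (x + a) - h (x - a))
        = (\<phi> a + \<phi> (- a)) * h x + (\<phi> a - \<phi> (- a)) * h x"
      by simp
    also have "\<dots> = 2 * (\<phi> a * h x)"
      by (simp add: algebra_simps)
    finally show ?thesis
      by simp
  qed
  have hom: "\<phi> (x + a) = \<phi> a * \<phi> x" for x a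
    by (rule mult) (rule eig(1))
  show "fst (p (x + y)) = fst (p x) * fst (p y)"
    using hom[of x y] by (simp add: \<phi>_def)
  have "\<psi> (0 + x) = \<phi> x * \<psi> 0"
    by (rule mult) (rule eig(2))
  then show "snd (p x) = fst (p x) * snd (p 0)"
    by (simp add: \<phi>_def \<psi>_def)
  have "\<phi> (- x) = cnj (\<phi> x)"
    using dom by (simp add: dominated_pairs_def \<phi>_def)
  then have "of_real ((norm (\<phi> x))\<^sup>2) = (1 :: complex)"
    using hom[of "- x" x] \<phi>0 unfolding complex_norm_square by simp
  then have "(norm (\<phi> x))\<^sup>2 = 1"
    using of_real_eq_1_iff by blast
  then show "norm (fst (p x)) = 1"
    using norm_ge_zero[of "\<phi> x"] unfolding power2_eq_1_iff \<phi>_def by linarith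
qed

text \<open>Among the pairs that maximise \<open>Re (\<psi> 0 - \<psi> g)\<close> there is an extreme one, and it is extreme among all
  pairs because the maximisers form a face. Its \<open>\<psi>\<close> is \<open>c \<phi>\<close> with \<open>Re (c (1 - \<phi> g)) > 0\<close>, so \<open>c \<noteq> 0\<close>
  and \<open>\<phi> g \<noteq> 1\<close>; dividing the modulus \<open>\<omega>\<close> by \<open>\<bar>c\<bar>\<close> makes \<open>\<phi>\<close> continuous at 0, hence everywhere.\<close>

lemma exists_char_from_pair:
  fixes \<omega> :: "'a::topological_ab_group_add \<Rightarrow> real"
  assumes p0: "p0 \<in> normalized_pairs C \<omega>" and \<omega>: "(\<omega> \<longlongrightarrow> 0) (nhds 0)"
    and g: "0 < Re (snd (p0 0) - snd (p0 g))"
  shows "\<exists>\<gamma> :: 'a dual. char \<gamma> g \<noteq> 1"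
proof -
  define S where "S = normalized_pairs C \<omega>"
  define L where "L p = Re (snd (p 0) - snd (p g))" for p :: "'a \<Rightarrow> complex \<times> complex"
  have contL: "continuous_on UNIV L"
    unfolding L_def by (intro continuous_intros) simp_all
  have "compact S" "closed S" "p0 \<in> S"
    unfolding S_def by (rule compact_normalized_pairs closed_normalized_pairs p0)+
  then obtain m where m: "m \<in> S" "\<And>p. p \<in> S \<Longrightarrow> L p \<le> L m"
    using continuous_attains_sup[of S L] continuous_on_subset[OF contL] by blast
  define F where "F = S \<inter> {p. L p = L m}"
  have clF: "closed {p. L p = L m}"
    by (intro closed_Collect_eq contL continuous_on_const)
  have "compact F" "closed F" "F \<noteq> {}"
    unfolding F_def using \<open>compact S\<close> \<open>closed S\<close> m(1) clF
    by (auto intro: compact_Int_closed closed_Int)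
  then obtain p where "p \<in> F"
    and ext: "\<And>q r t. q \<in> F \<Longrightarrow> r \<in> F \<Longrightarrow> 0 < t \<Longrightarrow> t < 1 \<Longrightarrow>
       p = (\<lambda>i. t *\<^sub>R q i + (1 - t) *\<^sub>R r i) \<Longrightarrow> q = p \<and> r = p"
    by (rule exists_extreme_point) blast
  then have p: "p \<in> S" "L p = L m"
    by (auto simp: F_def)
  have "q = p"
    if qr: "q \<in> S" "r \<in> S" and t: "0 < t" "t < 1"
      and pqr: "p = (\<lambda>i. t *\<^sub>R q i + (1 - t) *\<^sub>R r i)" for q r t
  proof -
    have "L m = t * L q + (1 - t) * L r"
      unfolding p(2)[symmetric] by (simp add: pqr L_def algebra_simps)
    then have "t * (L m - L q) + (1 - t) * (L m - L r) = 0"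
      by (simp add: algebra_simps)
    moreover have "0 \<le> t * (L m - L q)" "0 \<le> (1 - t) * (L m - L r)"
      using m(2)[OF qr(1)] m(2)[OF qr(2)] t by auto
    ultimately have "t * (L m - L q) = 0" "(1 - t) * (L m - L r) = 0"
      by linarith+
    then have "q \<in> F" "r \<in> F"
      using qr t by (auto simp: F_def)
    then show ?thesis
      using ext t pqr by blast
  qed
  then have "extreme_pair C \<omega> p"
    using p(1) unfolding extreme_pair_def S_def by blast
  note mult = extreme_pair_multiplicative[OF this]
  define \<phi> where "\<phi> x = fst (p x)" for x
  define c where "c = snd (p 0)"
  have hom: "\<phi> (x + y) = \<phi> x * \<phi> y" and unit: "norm (\<phi> x) = 1" and \<psi>: "snd (p x) = \<phi> x * c" for x y
    unfolding \<phi>_def c_def by (rule mult)+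
  have \<phi>0: "\<phi> 0 = 1"
    using p(1) by (simp add: S_def normalized_pairs_def \<phi>_def)
  have "0 < L p"
    using g m(2)[OF \<open>p0 \<in> S\<close>] unfolding p(2) by (simp add: L_def)
  then have pos: "0 < Re ((1 - \<phi> g) * c)"
    by (simp add: L_def \<psi> \<phi>0 algebra_simps)
  then have c: "c \<noteq> 0"
    by auto
  have "((\<lambda>y. \<phi> y - 1) \<longlongrightarrow> 0) (nhds 0)"
  proof (rule Lim_null_comparison)
    show "((\<lambda>y. \<omega> y / norm c) \<longlongrightarrow> 0) (nhds 0)"
      using tendsto_divide_zero[OF \<omega>] .
    show "\<forall>\<^sub>F y in nhds 0. norm (\<phi> y - 1) \<le> \<omega> y / norm c"
    proof (intro always_eventually allI)
      fix y
      have "norm ((\<phi> y - 1) * c) \<le> \<omega> y"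
        using dominated_pairs_bounds(5)[of p C \<omega> y] p(1) \<psi>[of y] \<psi>[of 0] \<phi>0
        by (simp add: S_def normalized_pairs_def \<phi>_def algebra_simps)
      then show "norm (\<phi> y - 1) \<le> \<omega> y / norm c"
        using c by (simp add: norm_mult pos_le_divide_eq)
    qed
  qed
  then have \<phi>1: "(\<phi> \<longlongrightarrow> 1) (nhds 0)"
    by (simp add: LIM_zero_iff)
  have "(\<phi> \<longlongrightarrow> \<phi> x) (at x)" for x
  proof -
    have "((\<lambda>y. y - x) \<longlongrightarrow> x - x) (at x)"
      by (intro tendsto_diff tendsto_ident_at tendsto_const)
    then have "((\<lambda>y. \<phi> (y - x)) \<longlongrightarrow> 1) (at x)"
      using filterlim_compose[OF \<phi>1] by simp
    then have "((\<lambda>y. \<phi> x * \<phi> (y - x)) \<longlongrightarrow> \<phi> x * 1) (at x)"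
      by (intro tendsto_mult tendsto_const)
    moreover have "\<phi> x * \<phi> (y - x) = \<phi> y" for y
      using hom[of x "y - x"] by simp
    ultimately show ?thesis
      by simp
  qed
  then have "continuous_on UNIV \<phi>"
    by (simp add: continuous_on_def)
  then have "char (Abs_dual \<phi>) = \<phi>"
    using hom unit by (intro Abs_dual_inverse) auto
  moreover have "\<phi> g \<noteq> 1"
    using pos by auto
  ultimately show ?thesis
    by metis
qed

section \<open>Characters separate points\<close>

context invariant_integral
begin

definition autocorr :: "('a \<Rightarrow> complex) \<Rightarrow> 'a \<Rightarrow> complex" where
  "autocorr v x = Ic (\<lambda>s. v (s + x) * cnj (v s))"

definition smear :: "('a \<Rightarrow> real) \<Rightarrow> ('a \<Rightarrow> complex) \<Rightarrow> 'a \<Rightarrow> complex" where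
  "smear f \<phi> x = Ic (\<lambda>s. of_real (f s) * \<phi> (x + s))"

lemma autocorr_zero: "autocorr v 0 = of_real (I (\<lambda>s. (norm (v s))\<^sup>2))"
  unfolding autocorr_def Ic_of_real[symmetric] by (simp only: complex_norm_square add_0_right)

text \<open>The inequality \<open>2 \<bar>u v\<bar> \<le> \<bar>u\<bar>\<^sup>2 + \<bar>v\<bar>\<^sup>2\<close> with invariance.\<close>

lemma norm_autocorr_le:
  assumes v: "bcs v"
  shows "norm (autocorr v x) \<le> Re (autocorr v 0)"
proof -
  define n where "n s = (norm (v s))\<^sup>2" for s
  have n: "bcs n" "bcs (\<lambda>s. n (s + x))"
    using bcs_norm_square[OF v] bcs_shift[OF bcs_norm_square[OF v], of x]
    by (simp_all add: n_def[abs_def])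
  have "norm (autocorr v x) \<le> I (\<lambda>s. 1 / 2 * (n (s + x) + n s))"
    unfolding autocorr_def
  proof (rule norm_Ic_le)
    show "bcs (\<lambda>s. v (s + x) * cnj (v s))"
      using bcs_correlation[OF v, of x 0] by simp
    show "bcs (\<lambda>s. 1 / 2 * (n (s + x) + n s))"
      by (intro bcs_scale bcs_add n)
    show "norm (v (s + x) * cnj (v s)) \<le> 1 / 2 * (n (s + x) + n s)" for s
      using sum_squares_bound[of "norm (v (s + x))" "norm (v s)"]
      by (simp add: n_def norm_mult)
  qed
  also have "\<dots> = I n"
    using scale[OF bcs_add[OF n(2,1)], of "1 / 2"] add[OF n(2,1)] shift[OF n(1), of x] by simp
  finally show ?thesis
    by (simp add: autocorr_zero n_def[abs_def])
qed

lemma autocorr_uminus: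
  assumes v: "bcs v"
  shows "autocorr v (- x) = cnj (autocorr v x)"
proof -
  have "autocorr v (- x) = Ic (\<lambda>s. v (s + x + - x) * cnj (v (s + x)))"
    unfolding autocorr_def using bcs_correlation[OF v, of "- x" 0]
    by (subst Ic_shift[of _ x, symmetric]) simp_all
  also have "\<dots> = Ic (\<lambda>s. cnj (v (s + x) * cnj (v s)))"
    by (simp add: mult.commute)
  also have "\<dots> = cnj (autocorr v x)"
    unfolding autocorr_def using bcs_correlation[OF v, of x 0] by (intro Ic_cnj) simp
  finally show ?thesis .
qed

text \<open>An autocorrelation stays an autocorrelation. This is why the operators test positivity.\<close>

lemma square_conv_autocorr:
  assumes v: "bcs v" and e: "norm e = 1"
  shows "square_conv e a (autocorr v) = autocorr (\<lambda>s. (v s + e * v (s + a)) / 2)"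
proof
  fix x
  have ee: "e * cnj e = 1"
    using e complex_norm_square[of e] by simp
  define c where "c y z = Ic (\<lambda>s. v (s + y) * cnj (v (s + z)))" for y z
  have c: "c y z = autocorr v (y - z)" for y z
    unfolding c_def autocorr_def using bcs_correlation[OF v, of "y - z" 0]
    by (subst Ic_shift[of "\<lambda>s. v (s + (y - z)) * cnj (v s)" z, symmetric]) (simp_all add: add.assoc)
  have "autocorr (\<lambda>s. (v s + e * v (s + a)) / 2) x
      = Ic (\<lambda>s. 1 / 4 * (v (s + x) * cnj (v (s + 0))) + (e / 4 * (v (s + (x + a)) * cnj (v (s + 0)))
          + (cnj e / 4 * (v (s + x) * cnj (v (s + a)))
          + e * cnj e / 4 * (v (s + (x + a)) * cnj (v (s + a))))))"
    unfolding autocorr_def by (intro arg_cong[of _ _ Ic] ext) (simp add: algebra_simps add_divide_distrib)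
  also have "\<dots> = 1 / 4 * c x 0 + (e / 4 * c (x + a) 0 + (cnj e / 4 * c x a + e * cnj e / 4 * c (x + a) a))"
    by (simp only: Ic_add Ic_scale bcs_add bcs_scale bcs_correlation[OF v] c_def)
  also have "\<dots> = square_conv e a (autocorr v) x"
    by (simp add: ee c square_conv_def add_divide_distrib)
  finally show "square_conv e a (autocorr v) x = autocorr (\<lambda>s. (v s + e * v (s + a)) / 2) x"
    by simp
qed

lemma bcs_smear:
  assumes f: "bcs f" and \<phi>: "bounded (range \<phi>)"
  shows "bcs (\<lambda>s. complex_of_real (f s) * \<phi> (x + s))"
  by (intro bcs_mult_right bcs_of_real f bounded_range_compose[OF \<phi>])

lemma square_conv_smear:
  assumes f: "bcs f" and \<phi>: "bounded (range \<phi>)"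
  shows "square_conv e a (smear f \<phi>) = smear f (square_conv e a \<phi>)"
proof
  fix x
  have "smear f (square_conv e a \<phi>) x
      = Ic (\<lambda>s. 1 / 2 * (of_real (f s) * \<phi> (x + s)) + (e / 4 * (of_real (f s) * \<phi> (x + a + s))
          + cnj e / 4 * (of_real (f s) * \<phi> (x - a + s))))"
    unfolding smear_def square_conv_def by (intro arg_cong[of _ _ Ic] ext) (simp add: algebra_simps add_divide_distrib)
  also have "\<dots> = 1 / 2 * smear f \<phi> x + (e / 4 * smear f \<phi> (x + a) + cnj e / 4 * smear f \<phi> (x - a))"
    by (simp only: Ic_add Ic_scale bcs_add bcs_scale bcs_smear[OF f \<phi>] smear_def)
  finally show "square_conv e a (smear f \<phi>) x = smear f (square_conv e a \<phi>) x"
    by (simp add: square_conv_def add_divide_distrib)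
qed

lemma bounded_autocorr: "bcs v \<Longrightarrow> bounded (range (autocorr v))"
  unfolding bounded_range_iff using norm_autocorr_le by blast

lemma square_ops_autocorr:
  assumes "R \<in> square_ops" "bcs f" "bcs v"
  shows "\<exists>w. bcs w \<and> R (autocorr v) = autocorr w \<and> R (smear f (autocorr v)) = smear f (autocorr w)"
  using assms(1,3)
proof (induction R arbitrary: v rule: square_ops.induct)
  case (comp R e a)
  define w where "w s = (v s + e * v (s + a)) / 2" for s
  have "bcs (\<lambda>s. 1 / 2 * (v s + e * v (s + a)))"
    by (intro bcs_scale bcs_add bcs_shift comp.prems)
  then have w: "bcs w"
    by (simp add: w_def[abs_def])
  have "square_conv e a (autocorr v) = autocorr w"
    unfolding w_def using comp by (intro square_conv_autocorr)
  moreover have "square_conv e a (smear f (autocorr v)) = smear f (autocorr w)"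
    using square_conv_smear[OF assms(2) bounded_autocorr[OF comp.prems]] calculation by simp
  ultimately show ?case
    using comp.IH[OF w] by simp
qed auto

text \<open>An operator \<open>R\<close> turns \<open>\<phi> = autocorr v\<close> into another autocorrelation and commutes with smearing, so it
  suffices to treat \<open>R\<close> as the identity. There, smearing integrates \<open>\<phi>\<close> against \<open>f\<close>, its increments
  integrate \<open>\<phi>\<close> against \<open>f (s - y) - f s\<close>, and \<open>\<bar>\<phi>\<bar> \<le> \<phi> 0\<close>.\<close>

lemma autocorr_smear_dominated:
  assumes f: "bcs f" and v: "bcs v"
  shows "(\<lambda>x. (autocorr v x, smear f (autocorr v) x))
    \<in> dominated_pairs (I (\<lambda>s. \<bar>f s\<bar>)) (\<lambda>y. I (\<lambda>s. \<bar>f (s - y) - f s\<bar>))"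
  unfolding dominated_pairs_def
proof (intro CollectI conjI allI ballI)
  show "fst (autocorr v (- x), smear f (autocorr v) (- x))
      = cnj (fst (autocorr v x, smear f (autocorr v) x))" for x
    using autocorr_uminus[OF v] by simp
  fix R :: "('a \<Rightarrow> complex) \<Rightarrow> 'a \<Rightarrow> complex" assume "R \<in> square_ops"
  then obtain w where w: "bcs w" and R: "R (autocorr v) = autocorr w"
      "R (smear f (autocorr v)) = smear f (autocorr w)"
    using square_ops_autocorr[OF _ f v] by blast
  define \<phi> where "\<phi> = autocorr w"
  define B where "B = Re (\<phi> 0)"
  have \<phi>: "bounded (range \<phi>)" and B: "norm (\<phi> x) \<le> B" for x
    unfolding \<phi>_def B_def by (rule bounded_autocorr[OF w] norm_autocorr_le[OF w])+
  have B0: "0 \<le> B"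
    using B norm_ge_zero order_trans by blast
  have bd: "norm (Ic (\<lambda>s. of_real (k s) * \<phi> s)) \<le> I (\<lambda>s. \<bar>k s\<bar>) * B" if k: "bcs k" for k
  proof -
    have "norm (Ic (\<lambda>s. of_real (k s) * \<phi> s)) \<le> I (\<lambda>s. B * \<bar>k s\<bar>)"
    proof (rule norm_Ic_le)
      show "bcs (\<lambda>s. complex_of_real (k s) * \<phi> s)"
        using bcs_smear[OF k \<phi>, of 0] by simp
      show "bcs (\<lambda>s. B * \<bar>k s\<bar>)"
        by (intro bcs_scale bcs_abs k)
      show "norm (complex_of_real (k s) * \<phi> s) \<le> B * \<bar>k s\<bar>" for s
        using mult_right_mono[OF B, of "\<bar>k s\<bar>"] by (simp add: norm_mult mult.commute)
    qed
    then show ?thesis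
      by (simp add: scale bcs_abs k mult.commute)
  qed
  have sm: "smear f \<phi> y = Ic (\<lambda>s. of_real (f (s - y)) * \<phi> s)" for y
    unfolding smear_def
    by (subst Ic_shift[of "\<lambda>s. of_real (f s) * \<phi> (y + s)" "- y", symmetric]) (simp_all add: bcs_smear f \<phi>)
  have fy: "bcs (\<lambda>s. f (s - y))" for y
    using bcs_shift[OF f, of "- y"] by simp
  have "smear f \<phi> y - smear f \<phi> 0 = Ic (\<lambda>s. of_real (f (s - y) - f s) * \<phi> s)" for y
    using Ic_diff[OF bcs_smear[OF fy[of y] \<phi>, of 0] bcs_smear[OF f \<phi>, of 0]]
    by (simp add: sm left_diff_distrib)
  then have diff: "norm (smear f \<phi> y - smear f \<phi> 0) \<le> I (\<lambda>s. \<bar>f (s - y) - f s\<bar>) * B" for y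
    using bd[OF bcs_diff[OF fy[of y] f]] by simp
  have "norm (smear f \<phi> 0) \<le> I (\<lambda>s. \<bar>f s\<bar>) * B"
    using bd[OF f] by (simp add: smear_def)
  then show "0 \<le> Re (R (\<lambda>x. fst (autocorr v x, smear f (autocorr v) x)) 0)"
    "norm (R (\<lambda>x. snd (autocorr v x, smear f (autocorr v) x)) 0)
      \<le> I (\<lambda>s. \<bar>f s\<bar>) * Re (R (\<lambda>x. fst (autocorr v x, smear f (autocorr v) x)) 0)"
    "norm (R (\<lambda>x. snd (autocorr v x, smear f (autocorr v) x)) y
        - R (\<lambda>x. snd (autocorr v x, smear f (autocorr v) x)) 0)
      \<le> I (\<lambda>s. \<bar>f (s - y) - f s\<bar>) * Re (R (\<lambda>x. fst (autocorr v x, smear f (autocorr v) x)) 0)" for y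
    using diff B0 by (simp_all add: R flip: \<phi>_def B_def)
qed

end

text \<open>The complete regularity of locally compact Hausdorff spaces, with the support cut down to a compact
  neighbourhood.\<close>

lemma exists_bump:
  fixes U :: "'a::t2_space set"
  assumes lc: "locally_compact_space (euclidean :: 'a topology)" and U: "open U" "a \<in> U"
  shows "\<exists>f :: 'a \<Rightarrow> real. continuous_on UNIV f \<and> bcs f \<and> f a = 1 \<and>
    (\<forall>x. f x \<in> {0..1}) \<and> (\<forall>x. f x \<noteq> 0 \<longrightarrow> x \<in> U)"
proof -
  obtain V D :: "'a set" where V: "open V" "a \<in> V" and D: "compact D" "V \<subseteq> D"
    using compact_neighbourhood[OF lc] by blast
  have "Hausdorff_space (euclidean :: 'a topology)"
    unfolding Hausdorff_space_def by (auto simp: disjnt_def) (metis hausdorff)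
  then have "completely_regular_space (euclidean :: 'a topology)"
    using lc by (intro locally_compact_regular_imp_completely_regular_space) auto
  moreover have "closedin euclidean (- (U \<inter> V))" "a \<in> topspace euclidean - (- (U \<inter> V))"
    using U V by (auto simp: open_Int closed_closedin[symmetric] intro: closed_Compl)
  ultimately obtain h where h: "continuous_map euclidean (top_of_set {0..1::real}) h" "h a = 0"
      "h ` (- (U \<inter> V)) \<subseteq> {1}"
    unfolding completely_regular_space_def by meson
  have cont: "continuous_on UNIV h" and h01: "h x \<in> {0..1}" for x
    using h(1) by (auto simp: continuous_map_in_subtopology)
  have out: "h x = 1" if "x \<notin> U \<inter> V" for x
    using h(3) that by blast
  show ?thesis
  proof (intro exI[of _ "\<lambda>x. 1 - h x"] conjI allI impI)
    show "continuous_on UNIV (\<lambda>x. 1 - h x)"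
      by (intro continuous_intros cont)
    show "bcs (\<lambda>x. 1 - h x)"
    proof (rule bcsI[OF D(1)])
      show "1 - h x = 0" if "x \<notin> D" for x
        using out[of x] that D(2) by auto
      show "norm (1 - h x) \<le> 1" for x
        using h01[of x] by auto
    qed
    show "1 - h x \<in> {0..1}" for x
      using h01[of x] by auto
    show "1 - h a = 1"
      using h(2) by simp
    show "x \<in> U" if "1 - h x \<noteq> 0" for x
      using out[of x] that by auto
  qed
qed

lemma neighbourhood_avoiding:
  fixes g :: "'a::{topological_ab_group_add, t2_space}"
  assumes "g \<noteq> 0"
  obtains U where "open U" "0 \<in> U" "\<And>a b c. a \<in> U \<Longrightarrow> b \<in> U \<Longrightarrow> c \<in> U \<Longrightarrow> a - b - c \<noteq> g"
proof -
  have "open (- {g})" "0 \<in> - {g}"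
    using assms by auto
  then obtain W where W: "open W" "0 \<in> W" "\<And>a b. a \<in> W \<Longrightarrow> b \<in> W \<Longrightarrow> a - b \<in> - {g}"
    by (rule neighbourhood_diff) blast
  obtain V where V: "open V" "0 \<in> V" "\<And>a b. a \<in> V \<Longrightarrow> b \<in> V \<Longrightarrow> a - b \<in> W"
    using W(1,2) by (rule neighbourhood_diff) blast
  show ?thesis
  proof (rule that[of "V \<inter> W"])
    show "a - b - c \<noteq> g" if "a \<in> V \<inter> W" "b \<in> V \<inter> W" "c \<in> V \<inter> W" for a b c
      using W(3)[OF V(3), of a b c] that by auto
  qed (use V W in auto)
qed

text \<open>With \<open>f\<close> supported in \<open>U\<close>, where \<open>g \<notin> U - U - U\<close>, the smeared autocorrelation of \<open>f\<close> vanishes at \<open>g\<close>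
  because the supports do not meet. At 0 it is positive, because the autocorrelation \<open>A\<close> of \<open>f\<close> is at
  least half of \<open>A 0\<close> near 0 and \<open>f\<close> is at least 1/2 there.\<close>

lemma characters_separate_points:
  fixes g :: "'a::{topological_ab_group_add, t2_space}"
  assumes lc: "locally_compact_space (euclidean :: 'a topology)" and g: "g \<noteq> 0"
  shows "\<exists>\<gamma> :: 'a dual. char \<gamma> g \<noteq> 1"
proof -
  obtain I :: "('a \<Rightarrow> real) \<Rightarrow> real" where "invariant_integral I"
    using exists_invariant_integral[OF lc] by blast
  then interpret invariant_integral I .
  obtain U where U: "open U" "0 \<in> U"
    and avoid: "\<And>a b c. a \<in> U \<Longrightarrow> b \<in> U \<Longrightarrow> c \<in> U \<Longrightarrow> a - b - c \<noteq> g"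
    by (rule neighbourhood_avoiding[OF g]) blast
  obtain f :: "'a \<Rightarrow> real" where cont: "continuous_on UNIV f" and f: "bcs f" and f0: "f 0 = 1"
    and f01: "\<forall>x. f x \<in> {0..1}" and fU: "\<forall>x. f x \<noteq> 0 \<longrightarrow> x \<in> U"
    using exists_bump[OF lc U] by blast
  have f_ge: "0 \<le> f x" and f_le: "f x \<le> 1" for x
    using f01[rule_format, of x] by auto
  define \<omega> where "\<omega> y = I (\<lambda>s. \<bar>f (s - y) - f s\<bar>)" for y
  have \<omega>: "(\<omega> \<longlongrightarrow> 0) (nhds 0)"
    unfolding \<omega>_def by (rule translation_tendsto_zero[OF lc f cont])
  define A where "A x = I (\<lambda>t. f (t + x) * f t)" for x
  have bA: "bcs (\<lambda>t. f (t + x) * f t)" for x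
    by (intro bcs_mult_left bcs_bounded bcs_shift f)
  have A_ge: "0 \<le> A x" for x
    unfolding A_def by (intro nonneg bA mult_nonneg_nonneg f_ge)
  define v where "v = (\<lambda>x. complex_of_real (f x))"
  have v: "bcs v"
    unfolding v_def by (rule bcs_of_real[OF f])
  have ac: "autocorr v = (\<lambda>x. of_real (A x))"
    by (intro ext) (simp add: autocorr_def v_def A_def flip: Ic_of_real)
  have sm: "smear f (autocorr v) x = of_real (I (\<lambda>s. f s * A (x + s)))" for x
    by (simp add: smear_def ac flip: Ic_of_real)
  have half: "open {x. 1 / 2 < f x}"
    by (rule open_Collect_less[OF continuous_on_const cont])
  have A0: "0 < A 0"
    unfolding A_def
  proof (rule positive_on_open)
    show "bcs (\<lambda>t. f (t + 0) * f t)"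
      by (rule bA)
    show "open {x. 1 / 2 < f x}" "0 \<in> {x. 1 / 2 < f x}"
      using half f0 by auto
    show "1 / 4 \<le> f (x + 0) * f x" if "x \<in> {x. 1 / 2 < f x}" for x
      using mult_mono[of "1 / 2" "f x" "1 / 2" "f x"] that by simp
  qed (use f_ge in auto)
  have A_near: "A 0 - A x \<le> \<omega> (- x)" for x
  proof -
    have "A 0 - A x = I (\<lambda>t. f (t + 0) * f t - f (t + x) * f t)"
      unfolding A_def by (rule diff[OF bA bA, symmetric])
    also have "\<dots> \<le> \<omega> (- x)"
      unfolding \<omega>_def
    proof (rule mono[OF bcs_diff[OF bA bA]])
      show "bcs (\<lambda>s. \<bar>f (s - - x) - f s\<bar>)"
        using bcs_abs[OF bcs_diff[OF bcs_shift[OF f, of x] f]] by simp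
      show "f (t + 0) * f t - f (t + x) * f t \<le> \<bar>f (t - - x) - f t\<bar>" for t
      proof -
        have "f (t + 0) * f t - f (t + x) * f t = (f t - f (t + x)) * f t"
          by (simp add: algebra_simps)
        also have "\<dots> \<le> \<bar>f t - f (t + x)\<bar> * 1"
          using f_ge f_le by (intro mult_mono) auto
        finally show ?thesis
          by (simp add: abs_minus_commute)
      qed
    qed
    finally show ?thesis .
  qed
  have "((\<lambda>x. \<omega> (- x)) \<longlongrightarrow> 0) (nhds 0)"
    using filterlim_compose[OF \<omega>, of uminus "nhds 0"] tendsto_uminus_nhds[of "0::'a"] by simp
  then have "\<forall>\<^sub>F x in nhds 0. \<omega> (- x) < A 0 / 2"
    using A0 by (intro order_tendstoD) auto
  then obtain N where N: "open N" "0 \<in> N" "\<And>x. x \<in> N \<Longrightarrow> \<omega> (- x) < A 0 / 2"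
    unfolding eventually_nhds by blast
  have bfA: "bcs (\<lambda>s. f s * A (0 + s))"
  proof (rule bcs_mult_right[OF f])
    have "\<bar>A s\<bar> \<le> Re (autocorr v 0)" for s
      using norm_autocorr_le[OF v, of s] by (simp add: ac)
    then show "bounded (range (\<lambda>s. A (0 + s)))"
      by (auto simp: bounded_range_iff)
  qed
  have pos: "0 < I (\<lambda>s. f s * A (0 + s))"
  proof (rule positive_on_open[OF bfA])
    show "open (N \<inter> {x. 1 / 2 < f x})" "0 \<in> N \<inter> {x. 1 / 2 < f x}"
      using half f0 N by auto
    show "0 < 1 / 2 * (A 0 / 2)"
      using A0 by simp
    show "1 / 2 * (A 0 / 2) \<le> f s * A (0 + s)" if "s \<in> N \<inter> {x. 1 / 2 < f x}" for s
      using that N(3)[of s] A_near[of s] A0 f_ge by (intro mult_mono) auto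
  qed (use f_ge A_ge in auto)
  have "f s * A (g + s) = 0" for s
  proof (cases "f s = 0")
    case False
    have "f (t + (g + s)) * f t = 0" for t
    proof (rule ccontr)
      assume "f (t + (g + s)) * f t \<noteq> 0"
      then have "t + (g + s) \<in> U" "t \<in> U" "s \<in> U"
        using fU False by auto
      then show False
        using avoid[of "t + (g + s)" t s] by simp
    qed
    then have "A (g + s) = 0"
      by (simp only: A_def zero)
    then show ?thesis
      by simp
  qed simp
  then have smg: "smear f (autocorr v) g = 0"
    by (simp only: sm zero of_real_0)
  define p where "p = (\<lambda>x. (autocorr v x, smear f (autocorr v) x))"
  define p0 where "p0 = (\<lambda>x. (1 / A 0) *\<^sub>R p x)"
  have "p \<in> dominated_pairs (I (\<lambda>s. \<bar>f s\<bar>)) \<omega>"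
    unfolding p_def \<omega>_def by (rule autocorr_smear_dominated[OF f v])
  then have "p0 \<in> dominated_pairs (I (\<lambda>s. \<bar>f s\<bar>)) \<omega>"
    unfolding p0_def using A0 by (intro scale_in_dominated_pairs) simp_all
  moreover have "fst (p0 0) = 1"
    using A0 by (simp add: p0_def p_def ac scaleR_conv_of_real)
  ultimately have "p0 \<in> normalized_pairs (I (\<lambda>s. \<bar>f s\<bar>)) \<omega>"
    by (simp add: normalized_pairs_def)
  moreover have "0 < Re (snd (p0 0) - snd (p0 g))"
    unfolding p0_def p_def snd_scaleR snd_conv smg using pos A0 by (simp add: sm)
  ultimately show ?thesis
    using exists_char_from_pair \<omega> by blast
qed

section \<open>Averages of characters along a Folner sequence\<close>

lemma continuous_on_char_eval: "continuous_on UNIV (\<lambda>\<gamma>::'a::topological_ab_group_add dual. char \<gamma> g)"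
  unfolding continuous_on_def
proof (intro ballI tendstoI)
  fix \<gamma> :: "'a dual" and e :: real assume "0 < e"
  then have "\<forall>\<^sub>F \<delta> in nhds \<gamma>. dist (char \<delta> g) (char \<gamma> g) < e"
    using eventually_nhds_dual[of "{g}" e \<gamma>] by simp
  then show "\<forall>\<^sub>F \<delta> in at \<gamma>. dist (char \<delta> g) (char \<gamma> g) < e"
    by (simp add: eventually_nhds_conv_at)
qed

text \<open>The difference of the two indicator functions is supported on the symmetric difference.\<close>

lemma norm_diff_set_integral_le:
  fixes h :: "'b \<Rightarrow> complex"
  assumes A: "A \<in> sets M" "emeasure M A < \<infinity>" and B: "B \<in> sets M" "emeasure M B < \<infinity>"
    and h: "h \<in> borel_measurable M" and bd: "\<And>x. norm (h x) \<le> 1"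
  shows "norm ((LINT x:A|M. h x) - (LINT x:B|M. h x)) \<le> measure M (sym_diff A B)"
proof -
  have int: "set_integrable M S h" if "S \<in> sets M" "emeasure M S < \<infinity>" for S
  proof -
    have "integrable M (\<lambda>x. indicator S x *\<^sub>R h x)"
    proof (rule Bochner_Integration.integrable_bound)
      show "integrable M (indicator S :: _ \<Rightarrow> real)"
        using that by simp
      show "(\<lambda>x. indicator S x *\<^sub>R h x) \<in> borel_measurable M"
        using that h by measurable
      show "AE x in M. norm (indicator S x *\<^sub>R h x) \<le> norm (indicator S x :: real)"
        using bd by (intro AE_I2) (simp add: indicator_def)
    qed
    then show ?thesis
      by (simp add: set_integrable_def)
  qed
  have D: "sym_diff A B \<in> sets M" "emeasure M (sym_diff A B) < \<infinity>"
  proof -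
    show "sym_diff A B \<in> sets M"
      using A B by auto
    have "emeasure M (sym_diff A B) \<le> emeasure M (A \<union> B)"
      using A B by (intro emeasure_mono) auto
    also have "\<dots> \<le> emeasure M A + emeasure M B"
      using A B by (intro emeasure_subadditive)
    finally show "emeasure M (sym_diff A B) < \<infinity>"
      using A B by (auto simp: less_top[symmetric] top_unique)
  qed
  have "(LINT x:A|M. h x) - (LINT x:B|M. h x)
      = (LINT x|M. indicator A x *\<^sub>R h x - indicator B x *\<^sub>R h x)"
    using int[OF A] int[OF B] unfolding set_lebesgue_integral_def set_integrable_def by simp
  also have "norm \<dots> \<le> (LINT x|M. indicator (sym_diff A B) x)"
  proof (intro order_trans[OF integral_norm_bound integral_mono])
    show "integrable M (\<lambda>x. norm (indicator A x *\<^sub>R h x - indicator B x *\<^sub>R h x))"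
      using int[OF A] int[OF B] unfolding set_integrable_def
      by (intro integrable_norm Bochner_Integration.integrable_diff)
    show "integrable M (indicator (sym_diff A B) :: _ \<Rightarrow> real)"
      using D by simp
    show "norm (indicator A x *\<^sub>R h x - indicator B x *\<^sub>R h x) \<le> indicator (sym_diff A B) x" for x
      using bd[of x] by (auto simp: indicator_def)
  qed
  also have "\<dots> = measure M (sym_diff A B)"
    using D by simp
  finally show ?thesis .
qed

lemma set_integral_translate_char:
  fixes M :: "'a::{topological_ab_group_add, t2_space} dual measure"
  assumes M: "haar_measure M" and F: "compact F"
  shows "(LINT \<gamma>:(+) a ` F|M. char \<gamma> g) = char a g * (LINT \<gamma>:F|M. char \<gamma> g)"
proof -
  have sets: "sets M = sets borel" and space: "space M = UNIV"
    using M sets_eq_imp_space_eq[of M borel] by (auto simp: haar_measure_def)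
  have inv: "emeasure M ((+) b ` A) = emeasure M A" if "A \<in> sets borel" for A b
  proof -
    have "\<forall>a. \<forall>A\<in>sets borel. emeasure M ((+) a ` A) = emeasure M A"
      using M unfolding haar_measure_def by (elim conjE)
    then show ?thesis
      using that by blast
  qed
  have add: "(+) a \<in> M \<rightarrow>\<^sub>M M"
    unfolding measurable_cong_sets[OF sets sets]
    by (intro borel_measurable_continuous_onI continuous_intros)
  have distr: "distr M M ((+) a) = M"
  proof (rule measure_eqI)
    fix A assume "A \<in> sets (distr M M ((+) a))"
    then have A: "A \<in> sets M"
      by simp
    have "(+) a -` A \<inter> space M = (+) (- a) ` A"
    proof (intro set_eqI iffI)
      fix x assume "x \<in> (+) a -` A \<inter> space M"
      then have "- a + (a + x) \<in> (+) (- a) ` A"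
        by (intro imageI) simp
      then show "x \<in> (+) (- a) ` A"
        by simp
    qed (auto simp: space)
    then show "emeasure (distr M M ((+) a)) A = emeasure M A"
      using inv[of A "- a"] A add by (simp add: emeasure_distr sets)
  qed simp
  have meas: "(\<lambda>\<gamma>. indicator ((+) a ` F) \<gamma> *\<^sub>R char \<gamma> g) \<in> borel_measurable M"
  proof -
    have "(+) a ` F \<in> sets borel"
      by (intro borel_closed compact_imp_closed compact_continuous_image continuous_intros F)
    moreover have "(\<lambda>\<gamma>. char \<gamma> g) \<in> borel_measurable borel"
      by (intro borel_measurable_continuous_onI continuous_on_char_eval)
    ultimately show ?thesis
      unfolding measurable_cong_sets[OF sets refl] by simp
  qed
  have "(LINT \<gamma>:(+) a ` F|M. char \<gamma> g)
      = (LINT \<gamma>|distr M M ((+) a). indicator ((+) a ` F) \<gamma> *\<^sub>R char \<gamma> g)"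
    unfolding set_lebesgue_integral_def distr ..
  also have "\<dots> = (LINT \<gamma>|M. indicator ((+) a ` F) (a + \<gamma>) *\<^sub>R char (a + \<gamma>) g)"
    by (rule integral_distr[OF add meas])
  also have "\<dots> = (LINT \<gamma>|M. char a g * (indicator F \<gamma> *\<^sub>R char \<gamma> g))"
    by (intro Bochner_Integration.integral_cong) (auto simp: indicator_def char_plus_dual)
  finally show ?thesis
    by (simp only: set_lebesgue_integral_def integral_mult_right_zero)
qed

theorem theorem1p4:
  fixes M :: "'a::{topological_ab_group_add, t2_space} dual measure"
    and F :: "nat \<Rightarrow> 'a dual set" and g :: 'a
  assumes "locally_compact_space (euclidean :: 'a topology)"
    and "haar_measure M"
    and "folner_sequence M F"
    and "g \<noteq> 0"
  shows "(\<lambda>n. (1 / complex_of_real (measure M (F n))) * (LINT \<gamma>:F n|M. char \<gamma> g)) \<longlonglongrightarrow> 0"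
proof -
  obtain a :: "'a dual" where a: "char a g \<noteq> 1"
    using characters_separate_points[OF assms(1,4)] by blast
  define c where "c = 1 - char a g"
  have c: "0 < norm c"
    using a by (simp add: c_def)
  have F: "compact (F n)" "0 < measure M (F n)" for n
    using assms(3) by (auto simp: folner_sequence_def)
  have sets: "sets M = sets borel"
    using assms(2) by (simp add: haar_measure_def)
  have fin: "K \<in> sets M" "emeasure M K < \<infinity>" if "compact K" for K
  proof -
    show "K \<in> sets M"
      using borel_closed[OF compact_imp_closed[OF that]] by (simp add: sets)
    have "\<forall>K. compact K \<longrightarrow> emeasure M K < \<infinity>"
      using assms(2) unfolding haar_measure_def by (elim conjE)
    then show "emeasure M K < \<infinity>"
      using that by blast
  qed
  have aF: "compact ((+) a ` F n)" for n
    by (intro compact_continuous_image continuous_intros F)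
  have meas: "(\<lambda>\<gamma>. char \<gamma> g) \<in> borel_measurable M"
    unfolding measurable_cong_sets[OF sets refl]
    by (intro borel_measurable_continuous_onI continuous_on_char_eval)
  define r where "r n = measure M (sym_diff (F n) ((+) a ` F n)) / measure M (F n)" for n
  have "r \<longlonglongrightarrow> 0"
    using assms(3) unfolding folner_sequence_def r_def by blast
  then have lim: "(\<lambda>n. r n / norm c) \<longlonglongrightarrow> 0"
    by (rule tendsto_divide_zero)
  have "norm ((1 / complex_of_real (measure M (F n))) * (LINT \<gamma>:F n|M. char \<gamma> g)) \<le> r n / norm c" for n
  proof -
    define J where "J = (LINT \<gamma>:F n|M. char \<gamma> g)"
    have "norm (J - char a g * J) \<le> measure M (sym_diff (F n) ((+) a ` F n))"
      unfolding J_def set_integral_translate_char[OF assms(2) F(1), symmetric]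
      by (intro norm_diff_set_integral_le fin F aF meas) simp
    moreover have "J - char a g * J = c * J"
      by (simp add: c_def algebra_simps)
    ultimately have "norm c * norm J \<le> r n * measure M (F n)"
      using F(2)[of n] by (simp add: norm_mult r_def)
    then show ?thesis
      using F(2)[of n] c unfolding J_def[symmetric] by (simp add: norm_mult norm_divide field_simps)
  qed
  then show ?thesis
    by (intro Lim_null_comparison[OF always_eventually lim] allI)
qed

end
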